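(* For any incircular net, there is a dual grid of quadrilaterals that has a $1$-parameter family of touching inscribed conics. The vertices of the dual grid are the centres of the circles of the incircular net, and the lines of the dual grid are angle bisector lines of the incircular net. Explicitly: for any incircular net with lines $a_0,\dots,a_m$ and $b_0,\dots,b_n$ there are lines $k_1,\dots,k_m$ and $l_1,\dots,l_n$ such that $k_i$ is an angle bisector of $a_{i-1}$ and $a_i$, $l_j$ is an angle bisector of $b_{j-1}$ and $b_j$, the point $k_i\cap l_j$ is the centre of the circle of the net inscribed in the quadrilateral $\Box(a_{i-1},b_{j-1},a_i,b_j)$, and the grid of quadrilaterals $\Box(k_{i-1},l_{j-1},k_i,l_j)$ ($2\le i\le m$, $2\le j\le n$) admits a $1$-parameter family of touching inscribed conics.
   Context: Lines are called generic if they are pairwise distinct and no three of them are concurrent. For generic lines $k,l,k',l'$, $\Box(k,l,k',l')$ denotes the quadrilateral with consecutive vertices $k\cap l,\ k\cap l',\ k'\cap l',\ k'\cap l$ and edge-lines $k,l',k',l$. Incircular net: let $a_0, \ldots, a_m$ and $b_0, \ldots, b_n$ be lines in the Euclidean plane. The $m \times n$ grid of quadrilaterals $\Box(a_{i-1}, b_{j-1}, a_i, b_{j})$ is an incircular net if and only if (i) the lines $a_0, \ldots, a_m$ and $b_0, \ldots, b_n$ are tangent to a conic $\mathcal{C}$, and (ii) the points $a_{i-1} \cap a_i$ ($1\le i\le m$) and $b_{j-1} \cap b_j$ ($1\le j\le n$) are contained in a conic $\mathcal{D}$ that is confocal with $\mathcal{C}$. (Conics $\mathcal{C},\mathcal{D}$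 are non-degenerate.) This is a characterisation of line grids all of whose quadrilaterals $\Box(a_{i-1}, b_{j-1}, a_i, b_{j})$ have inscribed circles (circles tangent to the four edge-lines); these are the circles of the net. Inscribed conics: the Euclidean plane is regarded as part of the real projective plane. A non-degenerate inscribed conic of a quadrilateral is a non-degenerate conic tangent to the four edge-lines at points (the tangency points) distinct from the vertices. In addition, exactly one degenerate conic counts as an inscribed conic: the double line supported on the line joining the two intersection points of opposite edge-lines; its tangency points are its intersection points with the edge-lines. An instance of touching inscribed conics of a grid is a choice of an inscribed conic in each quadrilateral such that for any two neighbouring quadrilaterals (sharing an edge) the two conics have the same tangency point on the common edge-line. The grid admits a $1$-parameter family of touching inscribed conics if, for every edge of the grid and every point $p$ on the corresponding edge-line different from the two endpoints of the edge, there is exactly one instance of touching inscribed conics with tangency point $p$ on that edge. *)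

theory Defs
  imports "HOL-Analysis.Analysis"
begin

text \<open>The real projective plane in homogeneous coordinates: points, lines and conics are
  nonzero vectors, covectors and symmetric matrices up to a nonzero factor.\<close>

definition proportional :: "'a::real_vector \<Rightarrow> 'a \<Rightarrow> bool" where
  "proportional x y \<longleftrightarrow> x \<noteq> 0 \<and> (\<exists>c. c \<noteq> 0 \<and> y = c *\<^sub>R x)"

lemma symp_proportional: "proportional x y \<Longrightarrow> proportional y x"
  unfolding proportional_def by (metis left_inverse scaleR_eq_0_iff scaleR_one scaleR_scaleR
    inverse_nonzero_iff_nonzero)

lemma transp_proportional: "proportional x y \<Longrightarrow> proportional y z \<Longrightarrow> proportional x z"
  unfolding proportional_def by (metis mult_eq_0_iff scaleR_scaleR)

definition conic_rel :: "real^3^3 \<Rightarrow> real^3^3 \<Rightarrow> bool" where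
  "conic_rel M N \<longleftrightarrow> transpose M = M \<and> proportional M N"

lemma transpose_scaleR_sym: "transpose (M :: real^3^3) = M \<Longrightarrow> transpose (c *\<^sub>R M) = c *\<^sub>R M"
  by (simp add: transpose_def vec_eq_iff)

quotient_type ppoint = "real^3" / partial: proportional
proof (rule part_equivpI)
  show "\<exists>x::real^3. proportional x x"
    by (rule exI[of _ "axis 1 1"]) (auto simp: proportional_def axis_eq_0_iff intro: exI[of _ 1])
qed (blast intro: sympI transpI symp_proportional transp_proportional)+

quotient_type pline = "real^3" / partial: proportional
proof (rule part_equivpI)
  show "\<exists>x::real^3. proportional x x"
    by (rule exI[of _ "axis 1 1"]) (auto simp: proportional_def axis_eq_0_iff intro: exI[of _ 1])
qed (blast intro: sympI transpI symp_proportional transp_proportional)+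

quotient_type conic = "real^3^3" / partial: conic_rel
proof (rule part_equivpI)
  have "(mat 1 :: real^3^3) \<noteq> 0"
    by (simp add: vec_eq_iff mat_def)
  then show "\<exists>x. conic_rel x x"
    by (intro exI[of _ "mat 1"]) (auto simp: conic_rel_def proportional_def intro: exI[of _ 1])
  show "symp conic_rel"
    by (rule sympI) (metis conic_rel_def proportional_def symp_proportional transpose_scaleR_sym)
  show "transp conic_rel"
    by (rule transpI) (metis conic_rel_def transp_proportional)
qed

lift_definition lies_on :: "ppoint \<Rightarrow> pline \<Rightarrow> bool" (infix \<open>lies'_on\<close> 50)
  is "\<lambda>x u. u \<bullet> x = 0"
  by (auto simp: proportional_def)

text \<open>Meaningful for distinct lines only.\<close>

definition meet :: "pline \<Rightarrow> pline \<Rightarrow> ppoint" where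
  "meet k l = (THE p. p lies_on k \<and> p lies_on l)"

definition generic :: "pline \<Rightarrow> pline \<Rightarrow> pline \<Rightarrow> pline \<Rightarrow> bool" where
  "generic k l k' l' \<longleftrightarrow> distinct [k, l, k', l'] \<and>
    (\<forall>u\<in>{k, l, k', l'}. \<forall>v\<in>{k, l, k', l'}. \<forall>w\<in>{k, l, k', l'}. distinct [u, v, w] \<longrightarrow>
      \<not> (\<exists>p. p lies_on u \<and> p lies_on v \<and> p lies_on w))"


subsection \<open>Conics\<close>

lift_definition nondegenerate :: "conic \<Rightarrow> bool"
  is "\<lambda>M. det M \<noteq> 0"
proof -
  fix M N :: "real^3^3"
  assume "conic_rel M N"
  then obtain c where "c \<noteq> 0" and N: "N = c *\<^sub>R M"
    by (auto simp: conic_rel_def proportional_def)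
  have "det N = c ^ 3 * det M"
    unfolding N by (simp add: det_3 power3_eq_cube algebra_simps)
  with \<open>c \<noteq> 0\<close> show "(det M \<noteq> 0) = (det N \<noteq> 0)"
    by simp
qed

lift_definition conjugate :: "conic \<Rightarrow> ppoint \<Rightarrow> ppoint \<Rightarrow> bool"
  is "\<lambda>M x y. x \<bullet> (M *v y) = 0"
  by (auto simp: conic_rel_def proportional_def scaleR_matrix_vector_assoc[symmetric]
      matrix_vector_mult_scaleR)

definition on_conic :: "conic \<Rightarrow> ppoint \<Rightarrow> bool" where
  "on_conic Q p \<longleftrightarrow> conjugate Q p p"

text \<open>The tangent line at a point \<open>p\<close> of a non-degenerate conic is the polar of \<open>p\<close>.\<close>

definition tangent_at :: "conic \<Rightarrow> pline \<Rightarrow> ppoint \<Rightarrow> bool" where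
  "tangent_at Q L p \<longleftrightarrow> on_conic Q p \<and> (\<forall>q. q lies_on L \<longleftrightarrow> conjugate Q p q)"

definition tangent :: "conic \<Rightarrow> pline \<Rightarrow> bool" where
  "tangent Q L \<longleftrightarrow> (\<exists>p. tangent_at Q L p)"

lift_definition double_line :: "pline \<Rightarrow> conic"
  is "\<lambda>u. (\<chi> i j. u $ i * u $ j)"
proof -
  fix u v :: "real^3"
  assume "proportional u v"
  then obtain c where "u \<noteq> 0" "c \<noteq> 0" and v: "v = c *\<^sub>R u"
    by (auto simp: proportional_def)
  moreover from \<open>u \<noteq> 0\<close> obtain i where "u $ i \<noteq> 0"
    by (auto simp: vec_eq_iff)
  then have "(\<chi> i j. u $ i * u $ j) \<noteq> 0"
    by (auto simp: vec_eq_iff intro!: exI[of _ i])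
  ultimately show "conic_rel (\<chi> i j. u $ i * u $ j) (\<chi> i j. v $ i * v $ j)"
    by (auto simp: conic_rel_def proportional_def transpose_def vec_eq_iff algebra_simps
        intro!: exI[of _ "c * c"])
qed


subsection \<open>The Euclidean plane\<close>

definition hom :: "real^2 \<Rightarrow> real^3" where
  "hom p = vector [p $ 1, p $ 2, 1]"

lemma hom_nonzero: "hom p \<noteq> 0"
  by (auto simp: hom_def vec_eq_iff forall_3)

lift_definition eucl :: "real^2 \<Rightarrow> ppoint" is hom
  by (auto simp: proportional_def hom_nonzero intro: exI[of _ 1])

lift_definition line_at_infinity :: pline is "axis 3 1"
  by (auto simp: proportional_def axis_eq_0_iff intro: exI[of _ 1])

definition line_points :: "pline \<Rightarrow> (real^2) set" where
  "line_points L = {p. eucl p lies_on L}"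

text \<open>For parallel \<open>a\<close>, \<open>b\<close> this is the mid-parallel; for intersecting distinct ones it holds
  for exactly the two lines through \<open>a \<inter> b\<close> that bisect the angles.\<close>

definition angle_bisector :: "pline \<Rightarrow> pline \<Rightarrow> pline \<Rightarrow> bool" where
  "angle_bisector k a b \<longleftrightarrow> k \<noteq> line_at_infinity \<and>
    (\<forall>p\<in>line_points k. infdist p (line_points a) = infdist p (line_points b))"

definition circle_tangent :: "real^2 \<Rightarrow> real \<Rightarrow> pline \<Rightarrow> bool" where
  "circle_tangent c r L \<longleftrightarrow> (\<exists>!p. p \<in> sphere c r \<inter> line_points L)"

definition inscribed_circle ::
  "real^2 \<Rightarrow> real \<Rightarrow> pline \<Rightarrow> pline \<Rightarrow> pline \<Rightarrow> pline \<Rightarrow> bool" where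
  "inscribed_circle c r k l k' l' \<longleftrightarrow> r > 0 \<and> (\<forall>e\<in>{k, l, k', l'}. circle_tangent c r e)"

text \<open>Focus and directrix: \<open>F\<close> is a focus if the conic has the equation
  \<open>dist p F\<^sup>2 = (e * dist p d)\<^sup>2\<close> with a directrix \<open>d\<close> and an eccentricity \<open>e\<close>. The
  right-hand side is written as the square of an affine function \<open>w \<bullet> hom p\<close>, which may be
  constant: then the conic is a circle (\<open>e = 0\<close>, directrix at infinity) with centre \<open>F\<close>.\<close>

definition focus_equation :: "real^3^3 \<Rightarrow> real^2 \<Rightarrow> bool" where
  "focus_equation M F \<longleftrightarrow> (\<exists>c w. c \<noteq> 0 \<and>
    (\<forall>p. hom p \<bullet> (M *v hom p) = c * ((dist p F)\<^sup>2 - (w \<bullet> hom p)\<^sup>2)))"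

lift_definition has_focus :: "conic \<Rightarrow> real^2 \<Rightarrow> bool" is focus_equation
proof -
  have *: "focus_equation N F" if "focus_equation M F" and "conic_rel M N" for M N F
  proof -
    from that obtain c w d where "c \<noteq> 0" "d \<noteq> 0" "N = d *\<^sub>R M"
      and "\<forall>p. hom p \<bullet> (M *v hom p) = c * ((dist p F)\<^sup>2 - (w \<bullet> hom p)\<^sup>2)"
      by (auto simp: conic_rel_def proportional_def focus_equation_def)
    then show ?thesis
      unfolding focus_equation_def
      by (intro exI[of _ "d * c"] exI[of _ w])
         (simp add: scaleR_matrix_vector_assoc[symmetric])
  qed
  have "conic_rel N M" if "conic_rel M N" for M N
    using that by (metis conic_rel_def proportional_def symp_proportional transpose_scaleR_sym)
  with * show "focus_equation M = focus_equation N" if "conic_rel M N" for M N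
    using that by blast
qed

text \<open>The second focus of a parabola is the point at infinity of its axis, at which the
  parabola touches the line at infinity. So ellipses and hyperbolas have two foci, a circle has
  its centre as only focus, and confocal parabolas share focus and axis.\<close>

definition foci :: "conic \<Rightarrow> ppoint set" where
  "foci Q = eucl ` {F. has_focus Q F} \<union> {p. tangent_at Q line_at_infinity p}"

text \<open>Every non-degenerate conic with real points has a focus in the Euclidean plane; the second
  conjunct excludes conics without real points.\<close>

definition confocal :: "conic \<Rightarrow> conic \<Rightarrow> bool" where
  "confocal Q Q' \<longleftrightarrow> foci Q = foci Q' \<and> (\<exists>F. has_focus Q F)"


subsection \<open>Grids and incircular nets\<close>

text \<open>The quadrilaterals are \<open>\<box>(a (i-1), b (j-1), a i, b j)\<close> for \<open>1 \<le> i \<le> m\<close>,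
  \<open>1 \<le> j \<le> n\<close>. If \<open>a (i-1) = a (i+1)\<close>, then the quadrilaterals on both sides of \<open>a i\<close> coincide;
  this is excluded. Lines further apart may coincide.\<close>

definition line_grid :: "nat \<Rightarrow> nat \<Rightarrow> (nat \<Rightarrow> pline) \<Rightarrow> (nat \<Rightarrow> pline) \<Rightarrow> bool" where
  "line_grid m n a b \<longleftrightarrow>
    (\<forall>i\<in>{1..m}. \<forall>j\<in>{1..n}. generic (a (i - 1)) (b (j - 1)) (a i) (b j)) \<and>
    (\<forall>i\<in>{1..<m}. a (i - 1) \<noteq> a (i + 1)) \<and>
    (\<forall>j\<in>{1..<n}. b (j - 1) \<noteq> b (j + 1))"

definition incircular_net :: "nat \<Rightarrow> nat \<Rightarrow> (nat \<Rightarrow> pline) \<Rightarrow> (nat \<Rightarrow> pline) \<Rightarrow> bool" where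
  "incircular_net m n a b \<longleftrightarrow>
    m \<ge> 1 \<and> n \<ge> 1 \<and> line_grid m n a b \<and>
    (\<forall>i\<le>m. a i \<noteq> line_at_infinity) \<and> (\<forall>j\<le>n. b j \<noteq> line_at_infinity) \<and>
    (\<forall>i\<le>m. \<forall>j\<le>n. meet (a i) (b j) \<in> range eucl) \<and>
    (\<exists>C D. nondegenerate C \<and> nondegenerate D \<and> confocal C D \<and>
      (\<forall>i\<le>m. tangent C (a i)) \<and> (\<forall>j\<le>n. tangent C (b j)) \<and>
      (\<forall>i\<in>{1..m}. on_conic D (meet (a (i - 1)) (a i))) \<and>
      (\<forall>j\<in>{1..n}. on_conic D (meet (b (j - 1)) (b j))))"


subsection \<open>Touching inscribed conics\<close>

definition tangency_point :: "conic \<Rightarrow> pline \<Rightarrow> ppoint \<Rightarrow> bool" where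
  "tangency_point Q e p \<longleftrightarrow>
    nondegenerate Q \<and> tangent_at Q e p \<or>
    (\<exists>h. Q = double_line h \<and> p lies_on h \<and> p lies_on e)"

definition vertices :: "pline \<Rightarrow> pline \<Rightarrow> pline \<Rightarrow> pline \<Rightarrow> ppoint set" where
  "vertices k l k' l' = {meet k l, meet k l', meet k' l', meet k' l}"

definition inscribed_conic :: "conic \<Rightarrow> pline \<Rightarrow> pline \<Rightarrow> pline \<Rightarrow> pline \<Rightarrow> bool" where
  "inscribed_conic Q k l k' l' \<longleftrightarrow>
    nondegenerate Q \<and>
      (\<forall>e\<in>{k, l, k', l'}. \<exists>p. tangent_at Q e p \<and> p \<notin> vertices k l k' l') \<or>
    (\<exists>h. Q = double_line h \<and> meet k k' lies_on h \<and> meet l l' lies_on h)"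

text \<open>\<open>Q (i, j)\<close> is the conic in \<open>\<box>(k (i-1), l (j-1), k i, l j)\<close>; \<open>Q\<close> is \<open>undefined\<close> outside
  the index range so that instances can be counted.\<close>

definition touching_instances ::
  "nat \<Rightarrow> nat \<Rightarrow> (nat \<Rightarrow> pline) \<Rightarrow> (nat \<Rightarrow> pline) \<Rightarrow> (nat \<times> nat \<Rightarrow> conic) set" where
  "touching_instances m n k l = {Q \<in> extensional ({1..m} \<times> {1..n}).
    (\<forall>i\<in>{1..m}. \<forall>j\<in>{1..n}. inscribed_conic (Q (i, j)) (k (i - 1)) (l (j - 1)) (k i) (l j)) \<and>
    (\<forall>i\<in>{1..<m}. \<forall>j\<in>{1..n}. \<exists>p.
      tangency_point (Q (i, j)) (k i) p \<and> tangency_point (Q (i + 1, j)) (k i) p) \<and>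
    (\<forall>i\<in>{1..m}. \<forall>j\<in>{1..<n}. \<exists>p.
      tangency_point (Q (i, j)) (l j) p \<and> tangency_point (Q (i, j + 1)) (l j) p)}"

text \<open>Every edge is addressed through a quadrilateral it belongs to.\<close>

definition admits_touching_family ::
  "nat \<Rightarrow> nat \<Rightarrow> (nat \<Rightarrow> pline) \<Rightarrow> (nat \<Rightarrow> pline) \<Rightarrow> bool" where
  "admits_touching_family m n k l \<longleftrightarrow>
    (\<forall>i\<in>{1..m}. \<forall>j\<in>{1..n}.
      (\<forall>e\<in>{k (i - 1), k i}. \<forall>p.
        p lies_on e \<and> p \<noteq> meet e (l (j - 1)) \<and> p \<noteq> meet e (l j) \<longrightarrow>
        (\<exists>!Q. Q \<in> touching_instances m n k l \<and> tangency_point (Q (i, j)) e p)) \<and>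
      (\<forall>e\<in>{l (j - 1), l j}. \<forall>p.
        p lies_on e \<and> p \<noteq> meet (k (i - 1)) e \<and> p \<noteq> meet (k i) e \<longrightarrow>
        (\<exists>!Q. Q \<in> touching_instances m n k l \<and> tangency_point (Q (i, j)) e p)))"

end

theory Submission imports Defs begin

text \<open>A conic with matrix \<open>M\<close> has a dual form \<open>u \<bullet> (N *v u)\<close> on line coordinates, where \<open>N\<close> is the inverse
of \<open>M\<close>; its zeros are the tangents of the conic. The proof rests on two ideas.

Confocal conics. The dual forms of confocal conics \<open>C\<close> and \<open>D\<close>, suitably scaled, satisfy
\<open>N' = \<kappa> N + (1 - \<kappa>) (u\<^sub>1\<^sup>2 + u\<^sub>2\<^sup>2)\<close> (\<open>confocal_dual\<close>): the dual form of a conic with foci \<open>f\<close>, \<open>g\<close>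
is \<open>u\<^sub>1\<^sup>2 + u\<^sub>2\<^sup>2 + (u \<bullet> f) (u \<bullet> g)\<close>, and only the scaling of \<open>g\<close> is left open by the foci. Now let \<open>u\<close>
be a line through a point \<open>x\<close> of \<open>D\<close>, and \<open>z\<close> a point of the tangent of \<open>D\<close> at \<open>x\<close>. Then
\<open>(u \<bullet> z)\<^sup>2 = (z \<bullet> M' z) (u \<bullet> N' u)\<close> (\<open>distance_formula\<close>). If \<open>u\<close> also touches \<open>C\<close>, the last factor is
\<open>(1 - \<kappa>) (u\<^sub>1\<^sup>2 + u\<^sub>2\<^sup>2)\<close>, so that the squared distance of \<open>z\<close>, with last
coordinate \<open>1\<close>, from \<open>u\<close> is \<open>(1 - \<kappa>) (z \<bullet> M' z)\<close>, which depends neither on \<open>u\<close> nor on \<open>x\<close>. Let \<open>k\<^sub>i\<close> be the tangent of \<open>D\<close> at \<open>a\<^bsub>i-1\<^esub> \<inter> a\<^sub>i\<close> and \<open>l\<^sub>j\<close> the one at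
\<open>b\<^bsub>j-1\<^esub> \<inter> b\<^sub>j\<close>. Every point of \<open>k\<^sub>i\<close> is equidistant from \<open>a\<^bsub>i-1\<^esub>\<close> and \<open>a\<^sub>i\<close>, and the point \<open>k\<^sub>i \<inter> l\<^sub>j\<close>
is equidistant from all four lines \<open>a\<^bsub>i-1\<^esub>\<close>, \<open>a\<^sub>i\<close>, \<open>b\<^bsub>j-1\<^esub>\<close>, \<open>b\<^sub>j\<close> (\<open>tangents_on_bisector\<close>,
\<open>circle_centre\<close>). The argument is uniform in the types of the conics and covers points at infinity.

Touching conics. The lines of the dual grid are thus tangents of one conic \<open>D\<close>, and this alone
yields the \<open>1\<close>-parameter family (\<open>tangent_grid_admits_touching_family\<close>). The inscribed conics
of a quadrilateral formed by tangents of \<open>D\<close> have a parameter \<open>s \<noteq> 0\<close> that is, on each of the four edges,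
the coordinate of the tangency point in the projective frame with \<open>0\<close> and \<open>\<infinity>\<close> at the endpoints and
\<open>1\<close> at the tangency point of \<open>D\<close> (\<open>touching_parameter\<close>). Two neighbouring quadrilaterals use the same
three points on their common edge, with the endpoints exchanged. Hence their conics touch if and only
if the parameters are inverse to each other. Around an inner vertex this is consistent, so that
the instances are the chessboard patterns of \<open>s\<close> and \<open>1 / s\<close>.\<close>

section \<open>Homogeneous coordinates\<close>

unbundle cross3_syntax

abbreviation pt :: "real^3 \<Rightarrow> ppoint" where "pt \<equiv> abs_ppoint"
abbreviation lin :: "real^3 \<Rightarrow> pline" where "lin \<equiv> abs_pline"
abbreviation con :: "real^3^3 \<Rightarrow> conic" where "con \<equiv> abs_conic"

lemma proportional_refl: "proportional x x \<longleftrightarrow> x \<noteq> 0"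
  by (auto simp: proportional_def intro: exI[of _ 1])

lemma pt_cases: obtains x where "x \<noteq> 0" "p = pt x"
  using Quotient_rep_reflp[OF Quotient_ppoint, of p] Quotient_abs_rep[OF Quotient_ppoint, of p]
  by (metis proportional_refl)

lemma lin_cases: obtains u where "u \<noteq> 0" "L = lin u"
  using Quotient_rep_reflp[OF Quotient_pline, of L] Quotient_abs_rep[OF Quotient_pline, of L]
  by (metis proportional_refl)

lemma con_cases: obtains M where "M \<noteq> 0" "transpose M = M" "Q = con M"
  using Quotient_rep_reflp[OF Quotient_conic, of Q] Quotient_abs_rep[OF Quotient_conic, of Q]
  by (metis proportional_refl conic_rel_def)

lemma pt_eq_iff: "x \<noteq> 0 \<Longrightarrow> y \<noteq> 0 \<Longrightarrow> pt x = pt y \<longleftrightarrow> (\<exists>c. c \<noteq> 0 \<and> y = c *\<^sub>R x)"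
  using Quotient_rel[OF Quotient_ppoint, of x y] by (auto simp: proportional_refl) (auto simp: proportional_def)

lemma lin_eq_iff: "x \<noteq> 0 \<Longrightarrow> y \<noteq> 0 \<Longrightarrow> lin x = lin y \<longleftrightarrow> (\<exists>c. c \<noteq> 0 \<and> y = c *\<^sub>R x)"
  using Quotient_rel[OF Quotient_pline, of x y] by (auto simp: proportional_refl) (auto simp: proportional_def)

lemma pt_scale: "c \<noteq> 0 \<Longrightarrow> x \<noteq> 0 \<Longrightarrow> pt (c *\<^sub>R x) = pt x"
  by (metis pt_eq_iff scaleR_eq_0_iff)

lemma lin_scale: "c \<noteq> 0 \<Longrightarrow> x \<noteq> 0 \<Longrightarrow> lin (c *\<^sub>R x) = lin x"
  by (metis lin_eq_iff scaleR_eq_0_iff)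

lemma con_scale:
  assumes "c \<noteq> 0" "M \<noteq> 0" "transpose M = M"
  shows "con (c *\<^sub>R M) = con M"
proof -
  have "conic_rel M (c *\<^sub>R M)"
    using assms by (auto simp: conic_rel_def proportional_def)
  then show ?thesis
    using Quotient_rel[OF Quotient_conic, of M "c *\<^sub>R M"] by auto
qed

lemma lies_on_iff: "x \<noteq> 0 \<Longrightarrow> u \<noteq> 0 \<Longrightarrow> pt x lies_on lin u \<longleftrightarrow> u \<bullet> x = 0"
  by (rule lies_on.abs_eq) (auto simp: proportional_refl)

lemma conjugate_iff:
  "M \<noteq> 0 \<Longrightarrow> transpose M = M \<Longrightarrow> x \<noteq> 0 \<Longrightarrow> y \<noteq> 0 \<Longrightarrow>
    conjugate (con M) (pt x) (pt y) \<longleftrightarrow> x \<bullet> (M *v y) = 0"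
  by (rule conjugate.abs_eq) (auto simp: proportional_refl conic_rel_def)

lemma nondegenerate_iff: "M \<noteq> 0 \<Longrightarrow> transpose M = M \<Longrightarrow> nondegenerate (con M) \<longleftrightarrow> det M \<noteq> 0"
  by (rule nondegenerate.abs_eq) (auto simp: proportional_refl conic_rel_def)

lemma has_focus_iff: "M \<noteq> 0 \<Longrightarrow> transpose M = M \<Longrightarrow> has_focus (con M) F \<longleftrightarrow> focus_equation M F"
  by (subst has_focus.abs_eq) (auto simp: proportional_refl conic_rel_def)

lemma double_line_ln: "u \<noteq> 0 \<Longrightarrow> double_line (lin u) = con (\<chi> i j. u $ i * u $ j)"
  by (rule double_line.abs_eq) (auto simp: proportional_refl)

lemma cross_zero_multiple:
  fixes w u :: "real^3"
  assumes "w \<noteq> 0" "w \<times> u = 0"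
  obtains c where "u = c *\<^sub>R w"
proof -
  have "(w \<bullet> u) *\<^sub>R w - (w \<bullet> w) *\<^sub>R u = 0"
    using Lagrange[of w w u] assms by simp
  then have "u = ((w \<bullet> u) / (w \<bullet> w)) *\<^sub>R w"
    using assms by (simp add: vec_eq_iff field_simps)
  with that show ?thesis .
qed

lemma proportional_iff_cross:
  fixes x y :: "real^3"
  assumes "x \<noteq> 0" "y \<noteq> 0"
  shows "(\<exists>c. c \<noteq> 0 \<and> y = c *\<^sub>R x) \<longleftrightarrow> x \<times> y = 0"
proof
  assume "x \<times> y = 0"
  then obtain c where "y = c *\<^sub>R x"
    using cross_zero_multiple assms by blast
  with assms show "\<exists>c. c \<noteq> 0 \<and> y = c *\<^sub>R x"
    by auto
qed (auto simp: cross_mult_right)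

lemma pt_eq_cross: "x \<noteq> 0 \<Longrightarrow> y \<noteq> 0 \<Longrightarrow> pt x = pt y \<longleftrightarrow> x \<times> y = 0"
  by (simp add: pt_eq_iff proportional_iff_cross)

lemma lin_eq_cross: "x \<noteq> 0 \<Longrightarrow> y \<noteq> 0 \<Longrightarrow> lin x = lin y \<longleftrightarrow> x \<times> y = 0"
  by (simp add: lin_eq_iff proportional_iff_cross)

lemma orthogonal_both:
  fixes x y u :: "real^3"
  assumes "x \<times> y \<noteq> 0" "u \<bullet> x = 0" "u \<bullet> y = 0"
  obtains c where "u = c *\<^sub>R (x \<times> y)"
proof -
  have "u \<times> (x \<times> y) = 0"
    using assms by (simp add: Lagrange)
  then have "(x \<times> y) \<times> u = 0"
    by (metis cross_skew neg_0_equal_iff_equal)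
  with cross_zero_multiple assms that show ?thesis by metis
qed

text \<open>The plane orthogonal to \<open>u \<times> v\<close> is spanned by \<open>u\<close> and \<open>v\<close>. Read projectively: a line through the
common point of \<open>u\<close> and \<open>v\<close> is a combination of the two.\<close>

lemma orthogonal_cross_combination:
  fixes u v w :: "real^3"
  assumes "u \<times> v \<noteq> 0" "w \<bullet> (u \<times> v) = 0"
  obtains \<alpha> \<beta> where "w = \<alpha> *\<^sub>R u + \<beta> *\<^sub>R v"
proof -
  define n where "n = u \<times> v"
  have "n \<bullet> n \<noteq> 0"
    using assms by (simp add: n_def)
  have "(n \<bullet> n) *\<^sub>R w = (n \<times> w) \<times> n"
    using assms cross_skew[of "n \<times> w" n] by (simp add: Lagrange n_def inner_commute)
  also have "n \<times> w = (w \<bullet> u) *\<^sub>R v - (w \<bullet> v) *\<^sub>R u"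
    using Lagrange[of w u v] cross_skew[of n w] by (simp add: n_def)
  also have "\<dots> \<times> n = (w \<bullet> u) *\<^sub>R (v \<times> n) - (w \<bullet> v) *\<^sub>R (u \<times> n)"
    by (simp add: cross_mult_left Cross3.left_diff_distrib)
  also have "\<dots> = ((w \<bullet> u) * (v \<bullet> v) - (w \<bullet> v) * (u \<bullet> v)) *\<^sub>R u +
      ((w \<bullet> v) * (u \<bullet> u) - (w \<bullet> u) * (v \<bullet> u)) *\<^sub>R v"
    (is "_ = ?a *\<^sub>R u + ?b *\<^sub>R v")
    by (simp add: n_def Lagrange algebra_simps)
  finally have "(1 / (n \<bullet> n)) *\<^sub>R ((n \<bullet> n) *\<^sub>R w) = (1 / (n \<bullet> n)) *\<^sub>R (?a *\<^sub>R u + ?b *\<^sub>R v)"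
    by (rule arg_cong)
  with \<open>n \<bullet> n \<noteq> 0\<close> that[of "?a / (n \<bullet> n)" "?b / (n \<bullet> n)"] show ?thesis
    by (simp add: scaleR_add_right)
qed

text \<open>The point \<open>u \<times> (v \<times> u)\<close> of the line \<open>u\<close> lies on \<open>v\<close> only if the lines coincide, so inclusion of
lines is already equality.\<close>

lemma line_eqI:
  fixes u v :: "real^3"
  assumes "u \<noteq> 0" "v \<noteq> 0" "\<And>y. y \<noteq> 0 \<Longrightarrow> u \<bullet> y = 0 \<Longrightarrow> v \<bullet> y = 0"
  shows "\<exists>c. c \<noteq> 0 \<and> v = c *\<^sub>R u"
proof -
  have "v \<bullet> (u \<times> v \<times> u) = 0" 
  proof (cases "u \<times> v \<times> u = 0")
    case False
    then show ?thesis using assms(3)[of "u \<times> v \<times> u"] by (simp add: dot_cross_self)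
  qed simp
  moreover have "v \<bullet> (u \<times> v \<times> u) = (u \<times> v) \<bullet> (u \<times> v)"
    by (simp add: vec_eq_iff forall_3 cross3_def inner_vec_def sum_3; algebra)
  ultimately have "u \<times> v = 0" by simp
  with assms show ?thesis by (simp add: proportional_iff_cross)
qed

lemma meet_lin:
  assumes "u \<noteq> 0" "v \<noteq> 0" "u \<times> v \<noteq> 0"
  shows "meet (lin u) (lin v) = pt (u \<times> v)"
  unfolding meet_def
proof (rule the_equality)
  show "pt (u \<times> v) lies_on lin u \<and> pt (u \<times> v) lies_on lin v"
    using assms by (simp add: lies_on_iff dot_cross_self)
next
  fix p
  assume p: "p lies_on lin u \<and> p lies_on lin v"
  obtain x where x: "x \<noteq> 0" "p = pt x"
    by (rule pt_cases)
  then have "x \<bullet> u = 0" "x \<bullet> v = 0"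
    using p assms by (auto simp: lies_on_iff inner_commute)
  then obtain c where "x = c *\<^sub>R (u \<times> v)"
    using assms(3) orthogonal_both by metis
  with x show "p = pt (u \<times> v)"
    by (simp add: pt_scale)
qed

lemma lies_on_both_iff_meet:
  assumes "k \<noteq> l"
  shows "p lies_on k \<and> p lies_on l \<longleftrightarrow> p = meet k l"
proof -
  obtain u where u: "u \<noteq> 0" "k = lin u" by (rule lin_cases)
  obtain v where v: "v \<noteq> 0" "l = lin v" by (rule lin_cases)
  note uv = u v
  with assms have c: "u \<times> v \<noteq> 0"
    by (simp add: lin_eq_cross)
  have "meet k l lies_on k" "meet k l lies_on l"
    using uv c by (auto simp: meet_lin lies_on_iff dot_cross_self)
  moreover have "p = meet k l" if p: "p lies_on k" "p lies_on l"
  proof -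
    obtain x where x: "x \<noteq> 0" "p = pt x"
      by (rule pt_cases)
    then have "x \<bullet> u = 0" "x \<bullet> v = 0"
      using p uv by (auto simp: lies_on_iff inner_commute)
    then obtain d where "x = d *\<^sub>R (u \<times> v)"
      using orthogonal_both[OF c] by metis
    with x uv c show ?thesis
      by (simp add: pt_scale meet_lin)
  qed
  ultimately show ?thesis by blast
qed

section \<open>Non-degenerate conics and their duals\<close>

text \<open>\<open>N\<close> is the matrix of the dual conic. The notion is symmetric in the two matrices, so that each
fact about points of a conic holds for its tangents as well.\<close>

definition dual_pair :: "real^3^3 \<Rightarrow> real^3^3 \<Rightarrow> bool" where
  "dual_pair M N \<longleftrightarrow> transpose M = M \<and> transpose N = N \<and> M ** N = mat 1 \<and> N ** M = mat 1"

lemma dual_pair_sym: "dual_pair M N \<Longrightarrow> dual_pair N M"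
  by (simp add: dual_pair_def)

lemma symmetric_form:
  fixes M :: "real^3^3"
  assumes "transpose M = M"
  shows "x \<bullet> (M *v y) = (M *v x) \<bullet> y"
  using dot_lmul_matrix[of x M y] transpose_matrix_vector[of M x] assms by simp

lemma dual_pair_cancel:
  assumes "dual_pair M N"
  shows "M *v (N *v x) = x" "N *v (M *v x) = x"
  using assms by (auto simp: dual_pair_def matrix_vector_mul_assoc)

lemma dual_pair_form:
  assumes "dual_pair M N"
  shows "x \<bullet> (M *v y) = y \<bullet> (M *v x)" "u \<bullet> (N *v v) = v \<bullet> (N *v u)"
proof -
  show "x \<bullet> (M *v y) = y \<bullet> (M *v x)"
    using assms symmetric_form[of M x y] inner_commute[of y "M *v x"] by (simp add: dual_pair_def)
  show "u \<bullet> (N *v v) = v \<bullet> (N *v u)"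
    using assms symmetric_form[of N u v] inner_commute[of v "N *v u"] by (simp add: dual_pair_def)
qed

lemma dual_pair_eq_0:
  assumes "dual_pair M N"
  shows "M *v x = 0 \<longleftrightarrow> x = 0"
  using dual_pair_cancel[OF assms] by (metis matrix_vector_mult_0_right)

lemma dual_pair_nonzero:
  assumes "dual_pair M N"
  shows "M \<noteq> 0" "det M \<noteq> 0" "transpose M = M"
proof -
  show "det M \<noteq> 0"
    using assms invertible_det_nz[of M] by (auto simp: dual_pair_def invertible_def)
  then show "M \<noteq> 0" by (auto simp: det_3)
  show "transpose M = M" using assms by (simp add: dual_pair_def)
qed

lemma dual_pair_exists:
  assumes "det M \<noteq> 0" "transpose M = M"
  obtains N where "dual_pair M N"
proof -
  obtain N where N: "M ** N = mat 1" "N ** M = mat 1"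
    using assms(1) by (auto simp: invertible_det_nz[symmetric] invertible_def)
  have "transpose N ** M = mat 1"
    using arg_cong[OF N(1), of transpose] assms by (simp add: matrix_transpose_mul transpose_mat)
  then have "transpose N = N"
    by (metis N(1) matrix_mul_assoc matrix_mul_lid matrix_mul_rid)
  with N assms that show ?thesis by (auto simp: dual_pair_def)
qed

lemma nondegenerate_cases:
  assumes "nondegenerate Q"
  obtains M N where "dual_pair M N" "Q = con M"
proof -
  obtain M where M: "M \<noteq> 0" "transpose M = M" "Q = con M" by (rule con_cases)
  with assms have "det M \<noteq> 0" by (simp add: nondegenerate_iff)
  then obtain N where "dual_pair M N"
    using dual_pair_exists[of M] M by auto
  with M that show ?thesis by blast
qed

lemma dual_pair_nondegenerate: "dual_pair M N \<Longrightarrow> nondegenerate (con M)"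
  by (simp add: dual_pair_nonzero nondegenerate_iff)

lemma tangent_at_iff:
  assumes "dual_pair M N" "u \<noteq> 0" "x \<noteq> 0"
  shows "tangent_at (con M) (lin u) (pt x) \<longleftrightarrow> u \<bullet> x = 0 \<and> (\<exists>c. c \<noteq> 0 \<and> u = c *\<^sub>R (M *v x))"
proof -
  note M = dual_pair_nonzero[OF assms(1)]
  have Mx: "M *v x \<noteq> 0"
    using assms dual_pair_eq_0 by blast
  have *: "(\<forall>q. q lies_on lin u \<longleftrightarrow> conjugate (con M) (pt x) q) \<longleftrightarrow>
      (\<forall>y. y \<noteq> 0 \<longrightarrow> u \<bullet> y = 0 \<longleftrightarrow> (M *v x) \<bullet> y = 0)"
  proof (rule iffI; intro allI impI)
    fix y :: "real^3"
    assume "\<forall>q. q lies_on lin u \<longleftrightarrow> conjugate (con M) (pt x) q" and y: "y \<noteq> 0"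
    then have "pt y lies_on lin u \<longleftrightarrow> conjugate (con M) (pt x) (pt y)"
      by blast
    then show "u \<bullet> y = 0 \<longleftrightarrow> (M *v x) \<bullet> y = 0"
      using assms M y by (simp add: lies_on_iff conjugate_iff symmetric_form)
  next
    fix q
    assume *: "\<forall>y. y \<noteq> 0 \<longrightarrow> u \<bullet> y = 0 \<longleftrightarrow> (M *v x) \<bullet> y = 0"
    obtain y where "y \<noteq> 0" "q = pt y" by (rule pt_cases)
    with * show "q lies_on lin u \<longleftrightarrow> conjugate (con M) (pt x) q"
      using assms M by (simp add: lies_on_iff conjugate_iff symmetric_form)
  qed
  also have "\<dots> \<longleftrightarrow> (\<exists>c. c \<noteq> 0 \<and> u = c *\<^sub>R (M *v x))"
    using line_eqI[OF Mx assms(2)] by auto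
  finally have "(\<forall>q. q lies_on lin u \<longleftrightarrow> conjugate (con M) (pt x) q) \<longleftrightarrow>
      (\<exists>c. c \<noteq> 0 \<and> u = c *\<^sub>R (M *v x))" .
  moreover have "on_conic (con M) (pt x) \<longleftrightarrow> x \<bullet> (M *v x) = 0"
    using assms M by (simp add: on_conic_def conjugate_iff)
  ultimately show ?thesis
    by (auto simp: tangent_at_def inner_commute)
qed

text \<open>The point of contact of a tangent is its pole.\<close>

lemma tangent_at_iff_polar:
  assumes "dual_pair M N" "u \<noteq> 0"
  shows "tangent_at (con M) (lin u) p \<longleftrightarrow> u \<bullet> (N *v u) = 0 \<and> p = pt (N *v u)"
proof -
  obtain x where x: "x \<noteq> 0" "p = pt x" by (rule pt_cases)
  have Nu: "N *v u \<noteq> 0"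
    using assms dual_pair_eq_0 dual_pair_sym by blast
  have "(\<exists>c. c \<noteq> 0 \<and> u = c *\<^sub>R (M *v x)) \<longleftrightarrow> (\<exists>c. c \<noteq> 0 \<and> N *v u = c *\<^sub>R x)"
  proof (rule ex_cong1, rule conj_cong[OF refl])
    fix c :: real
    show "u = c *\<^sub>R (M *v x) \<longleftrightarrow> N *v u = c *\<^sub>R x"
      using dual_pair_cancel(1)[OF assms(1), of u] dual_pair_cancel(2)[OF assms(1), of x]
        matrix_vector_mult_scaleR[of M c x] matrix_vector_mult_scaleR[of N c "M *v x"] by auto
  qed
  also have "\<dots> \<longleftrightarrow> p = pt (N *v u)"
    using x Nu by (simp add: pt_eq_iff)
  finally have 1: "tangent_at (con M) (lin u) p \<longleftrightarrow> u \<bullet> x = 0 \<and> p = pt (N *v u)"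
    using tangent_at_iff[OF assms x(1)] x(2) by simp
  have "u \<bullet> x = 0 \<longleftrightarrow> u \<bullet> (N *v u) = 0" if "p = pt (N *v u)"
    using that x Nu pt_eq_iff[of x "N *v u"] by auto
  with 1 show ?thesis by auto
qed

lemma tangent_iff:
  assumes "dual_pair M N" "u \<noteq> 0"
  shows "tangent (con M) (lin u) \<longleftrightarrow> u \<bullet> (N *v u) = 0"
  using assms by (auto simp: tangent_def tangent_at_iff_polar)

lemma on_conic_iff:
  assumes "dual_pair M N" "x \<noteq> 0"
  shows "on_conic (con M) (pt x) \<longleftrightarrow> x \<bullet> (M *v x) = 0"
  using assms dual_pair_nonzero[OF assms(1)] by (simp add: on_conic_def conjugate_iff)

text \<open>A non-degenerate form in three variables has no totally isotropic plane: otherwise \<open>M x\<close> and \<open>M y\<close>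
would both be orthogonal to that plane, hence proportional.\<close>

lemma isotropic_orthogonal_proportional:
  assumes "dual_pair M N" "x \<bullet> (M *v x) = 0" "y \<bullet> (M *v y) = 0" "x \<bullet> (M *v y) = 0"
  shows "x \<times> y = 0"
proof (rule ccontr)
  assume xy: "x \<times> y \<noteq> 0"
  have yx: "y \<bullet> (M *v x) = 0"
    using assms dual_pair_form(1) by metis
  obtain \<alpha> where a: "M *v x = \<alpha> *\<^sub>R (x \<times> y)"
    using orthogonal_both[OF xy, of "M *v x"] assms(2) yx by (auto simp: inner_commute)
  obtain \<beta> where b: "M *v y = \<beta> *\<^sub>R (x \<times> y)"
    using orthogonal_both[OF xy, of "M *v y"] assms(3,4) by (auto simp: inner_commute)
  have "M *v (\<beta> *\<^sub>R x - \<alpha> *\<^sub>R y) = 0"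
    by (simp add: a b matrix_vector_mult_diff_distrib matrix_vector_mult_scaleR)
  then have "\<beta> *\<^sub>R x - \<alpha> *\<^sub>R y = 0"
    using assms(1) dual_pair_eq_0 by blast
  then have "(\<beta> *\<^sub>R x - \<alpha> *\<^sub>R y) \<times> y = 0"
    by simp
  then have "\<beta> *\<^sub>R (x \<times> y) = 0"
    by (simp add: Cross3.left_diff_distrib cross_mult_left)
  with xy have "M *v y = 0" by (simp add: b)
  then have "y = 0" using assms(1) dual_pair_eq_0 by blast
  with xy show False by simp
qed

text \<open>The lines through a point form a two-dimensional space, and the dual form does not vanish on it
by \<open>isotropic_orthogonal_proportional\<close>; a non-zero quadratic form in two variables has at most two
zeros up to scaling.\<close>

lemma three_tangents_not_concurrent:
  assumes "dual_pair M N"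
    and "u \<bullet> (N *v u) = 0" "v \<bullet> (N *v v) = 0" "w \<bullet> (N *v w) = 0"
    and "u \<times> v \<noteq> 0" "u \<times> w \<noteq> 0" "v \<times> w \<noteq> 0"
  shows "w \<bullet> (u \<times> v) \<noteq> 0"
proof
  assume "w \<bullet> (u \<times> v) = 0"
  then obtain \<alpha> \<beta> where w: "w = \<alpha> *\<^sub>R u + \<beta> *\<^sub>R v"
    using assms(5) orthogonal_cross_combination by metis
  have uv: "u \<bullet> (N *v v) \<noteq> 0"
    using isotropic_orthogonal_proportional[OF dual_pair_sym[OF assms(1)] assms(2,3)] assms(5) by blast
  have "v \<bullet> (N *v u) = u \<bullet> (N *v v)"
    using assms(1) dual_pair_form by blast
  then have "w \<bullet> (N *v w) = 2 * (\<alpha> * \<beta> * (u \<bullet> (N *v v)))"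
    using assms by (simp add: w matrix_vector_right_distrib matrix_vector_mult_scaleR inner_add_left inner_add_right)
  with uv assms(4) have "\<alpha> = 0 \<or> \<beta> = 0" by simp
  with assms(6,7) w show False
    by (auto simp: cross_mult_right)
qed

lemma tangents_not_concurrent:
  assumes "nondegenerate Q" "tangent Q k" "tangent Q l" "tangent Q h" "distinct [k, l, h]"
  shows "\<not> (p lies_on k \<and> p lies_on l \<and> p lies_on h)"
proof
  assume p: "p lies_on k \<and> p lies_on l \<and> p lies_on h"
  obtain M N where MN: "dual_pair M N" and Q: "Q = con M"
    using assms(1) by (rule nondegenerate_cases)
  obtain u where u: "u \<noteq> 0" "k = lin u" by (rule lin_cases)
  obtain v where v: "v \<noteq> 0" "l = lin v" by (rule lin_cases)
  obtain w where w: "w \<noteq> 0" "h = lin w" by (rule lin_cases)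
  note uvw = u v w
  obtain x where x: "x \<noteq> 0" "p = pt x" by (rule pt_cases)
  have uv: "u \<times> v \<noteq> 0" "u \<times> w \<noteq> 0" "v \<times> w \<noteq> 0"
    using assms(5) uvw by (auto simp: lin_eq_cross)
  have o: "u \<bullet> x = 0" "v \<bullet> x = 0" "w \<bullet> x = 0"
    using p x uvw by (auto simp: lies_on_iff)
  then obtain c where c: "x = c *\<^sub>R (u \<times> v)"
    using orthogonal_both[OF uv(1), of x] by (auto simp: inner_commute)
  then have "w \<bullet> (u \<times> v) = 0"
    using o x by auto
  then show False
    using three_tangents_not_concurrent[OF MN] uv assms uvw Q MN
    by (auto simp: tangent_iff)
qed

text \<open>On the tangent \<open>M x\<close> the form of the conic has the radical \<open>x\<close>. The pole \<open>N u\<close> of a line \<open>u\<close> through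
\<open>x\<close> lies on this tangent, so that \<open>N u = \<alpha> x + \<beta> y\<close>, and each of the products in question only sees
the coefficient \<open>\<beta>\<close>. What matters later is that the first factor on the right does not involve \<open>u\<close>
and \<open>x\<close>.\<close>

lemma distance_formula:
  assumes "dual_pair M N" "x \<noteq> 0" "x \<bullet> (M *v x) = 0" "y \<bullet> (M *v x) = 0" "u \<bullet> x = 0"
  shows "(u \<bullet> y)\<^sup>2 = (y \<bullet> (M *v y)) * (u \<bullet> (N *v u))"
proof (cases "x \<times> y = 0")
  case True
  then obtain c where "y = c *\<^sub>R x"
    using assms cross_zero_multiple by blast
  then show ?thesis
    using assms by (simp add: matrix_vector_mult_scaleR)
next
  case False
  have xMy: "x \<bullet> (M *v y) = 0"
    using assms dual_pair_form(1) by metis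
  obtain \<gamma> where g: "M *v x = \<gamma> *\<^sub>R (x \<times> y)"
    using orthogonal_both[OF False, of "M *v x"] assms(3,4) by (auto simp: inner_commute)
  with assms have g0: "\<gamma> \<noteq> 0"
    using dual_pair_eq_0 by auto
  have "(N *v u) \<bullet> (M *v x) = 0"
    using assms dual_pair_nonzero(3)[OF assms(1)] dual_pair_cancel(1)[OF assms(1), of u]
    by (simp add: symmetric_form)
  then have "(N *v u) \<bullet> (x \<times> y) = 0"
    using g0 by (simp add: g)
  then obtain \<alpha> \<beta> where z: "N *v u = \<alpha> *\<^sub>R x + \<beta> *\<^sub>R y"
    using False orthogonal_cross_combination by metis
  have "u = M *v (N *v u)"
    using assms by (simp add: dual_pair_cancel)
  then have u: "u = \<alpha> *\<^sub>R (M *v x) + \<beta> *\<^sub>R (M *v y)"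
    by (simp add: z matrix_vector_right_distrib matrix_vector_mult_scaleR)
  have 1: "u \<bullet> y = \<beta> * (y \<bullet> (M *v y))"
    using assms(4) by (subst inner_commute) (simp add: u inner_add_right)
  have 2: "u \<bullet> (N *v u) = \<beta> * \<beta> * (y \<bullet> (M *v y))"
    using assms 1 by (simp add: z inner_add_right)
  show ?thesis
    by (simp add: 1 2 power2_eq_square)
qed

section \<open>Dual forms of confocal conics\<close>

text \<open>The matrix of the quadratic form \<open>(dist p F)\<^sup>2 - (w \<bullet> hom p)\<^sup>2\<close>.\<close>

definition focal_form :: "real^2 \<Rightarrow> real^3 \<Rightarrow> real^3^3" where
  "focal_form F w = vector [
    vector [1 - w $ 1 * w $ 1, - w $ 1 * w $ 2, - F $ 1 - w $ 1 * w $ 3],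
    vector [- w $ 1 * w $ 2, 1 - w $ 2 * w $ 2, - F $ 2 - w $ 2 * w $ 3],
    vector [- F $ 1 - w $ 1 * w $ 3, - F $ 2 - w $ 2 * w $ 3, (F $ 1)\<^sup>2 + (F $ 2)\<^sup>2 - w $ 3 * w $ 3]]"

text \<open>Homogeneous coordinates of the second focus of the conic \<open>focal_form F w\<close>. The eccentricity is the
length of \<open>(w\<^sub>1, w\<^sub>2)\<close>: if it is \<open>0\<close>, the formula gives \<open>F\<close> again; if it is \<open>1\<close>, the last coordinate
vanishes and the second focus is the point at infinity of the axis of a parabola. The scaling is chosen
to make \<open>focal_dual_inverse\<close> true.\<close>

definition second_focus :: "real^2 \<Rightarrow> real^3 \<Rightarrow> real^3" where
  "second_focus F w = (let d = w \<bullet> hom F; s = ((w $ 1)\<^sup>2 + (w $ 2)\<^sup>2 - 1) / d\<^sup>2 in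
     vector [s * F $ 1 - 2 * w $ 1 / d, s * F $ 2 - 2 * w $ 2 / d, s])"

text \<open>The form \<open>u\<^sub>1\<^sup>2 + u\<^sub>2\<^sup>2 + (u \<bullet> f) (u \<bullet> g)\<close>. On the lines through \<open>f\<close> or \<open>g\<close> it agrees with
\<open>u\<^sub>1\<^sup>2 + u\<^sub>2\<^sup>2\<close>, which is the dual characterisation of a focus.\<close>

definition focal_dual :: "real^3 \<Rightarrow> real^3 \<Rightarrow> real^3^3" where
  "focal_dual f g = (\<chi> i j. (if i = j \<and> i \<noteq> 3 then 1 else 0) + (f $ i * g $ j + g $ i * f $ j) / 2)"

lemma hom_components [simp]: "hom p $ 1 = p $ 1" "hom p $ 2 = p $ 2" "hom p $ 3 = 1"
  by (simp_all add: hom_def)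

lemma dist_sq_plane: "(dist p q)\<^sup>2 = (p $ 1 - q $ 1)\<^sup>2 + (p $ 2 - q $ 2)\<^sup>2" for p q :: "real^2"
  by (simp add: dist_norm norm_eq_sqrt_inner inner_vec_def sum_2 power2_eq_square)

lemma focal_form_value: "hom p \<bullet> (focal_form F w *v hom p) = (dist p F)\<^sup>2 - (w \<bullet> hom p)\<^sup>2"
  unfolding dist_sq_plane
  by (simp add: focal_form_def matrix_vector_mult_def inner_vec_def sum_3 power2_eq_square algebra_simps)

lemma focal_form_symmetric: "transpose (focal_form F w) = focal_form F w"
  by (simp add: focal_form_def transpose_def vec_eq_iff forall_3)

lemma focal_form_det: "det (focal_form F w) = - (w \<bullet> hom F)\<^sup>2"
  by (simp add: focal_form_def det_3 inner_vec_def sum_3 power2_eq_square algebra_simps)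

text \<open>The value of a quadratic form at six points of the affine plane determines its six coefficients.\<close>

lemma form_affine_eq:
  assumes "transpose M = M" "transpose M' = M'"
    and "\<And>p. hom p \<bullet> (M *v hom p) = hom p \<bullet> (M' *v hom p)"
  shows "M = M'"
proof -
  have e: "hom p \<bullet> (K *v hom p) = K $ 1 $ 1 * (p $ 1)\<^sup>2 + K $ 2 $ 2 * (p $ 2)\<^sup>2 + K $ 3 $ 3 +
      2 * K $ 1 $ 2 * p $ 1 * p $ 2 + 2 * K $ 1 $ 3 * p $ 1 + 2 * K $ 2 $ 3 * p $ 2"
    if "K $ 2 $ 1 = K $ 1 $ 2" "K $ 3 $ 1 = K $ 1 $ 3" "K $ 3 $ 2 = K $ 2 $ 3" for K p
    using that by (simp add: matrix_vector_mult_def inner_vec_def sum_3 power2_eq_square algebra_simps)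
  have s: "K $ 2 $ 1 = K $ 1 $ 2" "K $ 3 $ 1 = K $ 1 $ 3" "K $ 3 $ 2 = K $ 2 $ 3" if "transpose K = K" for K :: "real^3^3"
    using arg_cong[OF that, of "\<lambda>A. A $ 1 $ 2"] arg_cong[OF that, of "\<lambda>A. A $ 1 $ 3"]
      arg_cong[OF that, of "\<lambda>A. A $ 2 $ 3"] by (simp_all add: transpose_def)
  note E = assms(3)[unfolded e[OF s[OF assms(1)]] e[OF s[OF assms(2)]]]
  show ?thesis
    using E[of "vector [0, 0]"] E[of "vector [1, 0]"] E[of "vector [-1, 0]"] E[of "vector [0, 1]"]
      E[of "vector [0, -1]"] E[of "vector [1, 1]"] s[OF assms(1)] s[OF assms(2)]
    by (simp add: vec_eq_iff forall_3)
qed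

lemma focal_dual_inverse:
  assumes "w \<bullet> hom F \<noteq> 0"
  shows "dual_pair (focal_form F w) (focal_dual (hom F) (second_focus F w))"
proof -
  define d where "d = w \<bullet> hom F"
  have d: "d \<noteq> 0" using assms by (simp add: d_def)
  define \<alpha> \<beta> s where "\<alpha> = w $ 1 / d" and "\<beta> = w $ 2 / d" and "s = ((w $ 1)\<^sup>2 + (w $ 2)\<^sup>2 - 1) / d\<^sup>2"
  have w12: "w $ 1 = d * \<alpha>" "w $ 2 = d * \<beta>"
    using d by (simp_all add: \<alpha>_def \<beta>_def)
  have ds: "d * d * s = d * d * (\<alpha> * \<alpha> + \<beta> * \<beta>) - 1"
    using d by (simp add: s_def \<alpha>_def \<beta>_def power2_eq_square field_simps)
  have w3: "w $ 3 = d * (1 - \<alpha> * F $ 1 - \<beta> * F $ 2)"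
  proof -
    have "d * (1 - \<alpha> * F $ 1 - \<beta> * F $ 2) = d - (d * \<alpha>) * F $ 1 - (d * \<beta>) * F $ 2"
      by (simp add: algebra_simps)
    also have "\<dots> = w $ 3"
      unfolding w12[symmetric] by (simp add: d_def inner_vec_def sum_3)
    finally show ?thesis by simp
  qed
  have g: "second_focus F w = vector [s * F $ 1 - 2 * \<alpha>, s * F $ 2 - 2 * \<beta>, s]"
    by (simp add: second_focus_def Let_def d_def[symmetric] \<alpha>_def \<beta>_def s_def)
  have S: "focal_dual (hom F) (second_focus F w) = vector [
    vector [1 + s * F $ 1 * F $ 1 - 2 * \<alpha> * F $ 1, s * F $ 1 * F $ 2 - \<alpha> * F $ 2 - \<beta> * F $ 1, s * F $ 1 - \<alpha>],
    vector [s * F $ 1 * F $ 2 - \<alpha> * F $ 2 - \<beta> * F $ 1, 1 + s * F $ 2 * F $ 2 - 2 * \<beta> * F $ 2, s * F $ 2 - \<beta>],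
    vector [s * F $ 1 - \<alpha>, s * F $ 2 - \<beta>, s]]"
    unfolding g focal_dual_def by (simp add: vec_eq_iff forall_3 field_simps)
  have P: "focal_form F w = vector [
    vector [1 - d * d * \<alpha> * \<alpha>, - d * d * \<alpha> * \<beta>, - F $ 1 - d * d * \<alpha> * (1 - \<alpha> * F $ 1 - \<beta> * F $ 2)],
    vector [- d * d * \<alpha> * \<beta>, 1 - d * d * \<beta> * \<beta>, - F $ 2 - d * d * \<beta> * (1 - \<alpha> * F $ 1 - \<beta> * F $ 2)],
    vector [- F $ 1 - d * d * \<alpha> * (1 - \<alpha> * F $ 1 - \<beta> * F $ 2), - F $ 2 - d * d * \<beta> * (1 - \<alpha> * F $ 1 - \<beta> * F $ 2),
      F $ 1 * F $ 1 + F $ 2 * F $ 2 - d * d * (1 - \<alpha> * F $ 1 - \<beta> * F $ 2) * (1 - \<alpha> * F $ 1 - \<beta> * F $ 2)]]"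
    unfolding focal_form_def w3 w12 by (simp add: vec_eq_iff forall_3 power2_eq_square)
  define D x y where "D = d * d" and "x = F $ 1" and "y = F $ 2"
  have Ds: "D * s = D * (\<alpha> * \<alpha> + \<beta> * \<beta>) - 1"
    using ds by (simp add: D_def)
  have 1: "focal_form F w ** focal_dual (hom F) (second_focus F w) = mat 1"
    unfolding S P x_def[symmetric] y_def[symmetric] mult_minus_left D_def[symmetric]
    by (simp add: matrix_matrix_mult_def mat_def vec_eq_iff forall_3 sum_3 flip: D_def,
        intro conjI; use Ds in algebra)
  then have 2: "focal_dual (hom F) (second_focus F w) ** focal_form F w = mat 1"
    by (simp add: matrix_left_right_inverse)
  have "transpose (focal_dual (hom F) (second_focus F w)) = focal_dual (hom F) (second_focus F w)"
    by (simp add: focal_dual_def transpose_def vec_eq_iff algebra_simps)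
  with 1 2 focal_form_symmetric show ?thesis
    by (simp add: dual_pair_def)
qed

lemma focal_form_con:
  assumes "nondegenerate Q" "has_focus Q F"
  obtains w where "Q = con (focal_form F w)" "w \<bullet> hom F \<noteq> 0"
proof -
  obtain M where M: "M \<noteq> 0" "transpose M = M" "Q = con M" by (rule con_cases)
  with assms have "focus_equation M F" by (simp add: has_focus_iff)
  then obtain c w where c: "c \<noteq> 0"
    and e: "\<And>p. hom p \<bullet> (M *v hom p) = c * ((dist p F)\<^sup>2 - (w \<bullet> hom p)\<^sup>2)"
    by (auto simp: focus_equation_def)
  have Mc: "M = c *\<^sub>R focal_form F w"
  proof (rule form_affine_eq[OF M(2)])
    show "transpose (c *\<^sub>R focal_form F w) = c *\<^sub>R focal_form F w"
      by (simp add: transpose_scaleR_sym focal_form_symmetric)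
  qed (simp add: e scaleR_matrix_vector_assoc[symmetric] focal_form_value)
  have "focal_form F w \<noteq> 0"
    using M(1) Mc by auto
  then have Q: "Q = con (focal_form F w)"
    using M(3) Mc c by (simp add: con_scale focal_form_symmetric)
  then have "det (focal_form F w) \<noteq> 0"
    using assms(1) \<open>focal_form F w \<noteq> 0\<close> by (simp add: nondegenerate_iff focal_form_symmetric)
  then have "w \<bullet> hom F \<noteq> 0"
    by (simp add: focal_form_det)
  with Q that show ?thesis by blast
qed

lemma eucl_pt: "eucl p = pt (hom p)"
  by (rule eucl.abs_eq)

lemma infinity_lin: "line_at_infinity = lin (axis 3 1)"
  by (rule line_at_infinity.abs_eq)

lemma eucl_not_at_infinity: "\<not> eucl p lies_on line_at_infinity"
  by (simp add: eucl_pt infinity_lin lies_on_iff hom_nonzero axis_eq_0_iff inner_axis')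

lemma eucl_inj: "eucl p = eucl q \<longleftrightarrow> p = q"
proof
  assume "eucl p = eucl q"
  then obtain c where "hom q = c *\<^sub>R hom p"
    by (auto simp: eucl_pt pt_eq_iff hom_nonzero)
  then show "p = q"
    by (simp add: hom_def vec_eq_iff forall_3 forall_2)
qed simp

lemma tangent_at_lies_on: "nondegenerate Q \<Longrightarrow> tangent_at Q L p \<Longrightarrow> p lies_on L"
  by (auto simp: tangent_at_def on_conic_def)

lemma focal_dual_form:
  "u \<bullet> (focal_dual f g *v v) = u $ 1 * v $ 1 + u $ 2 * v $ 2 + ((u \<bullet> f) * (v \<bullet> g) + (v \<bullet> f) * (u \<bullet> g)) / 2"
  by (simp add: focal_dual_def matrix_vector_mult_def inner_vec_def sum_3 field_simps)

lemma axis_3: "(axis 3 1 :: real^3) $ 1 = 0" "(axis 3 1 :: real^3) $ 2 = 0" "(axis 3 1 :: real^3) $ 3 = 1"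
  by (simp_all add: axis_def)

lemma second_focus_nonzero:
  assumes "w \<bullet> hom F \<noteq> 0" shows "second_focus F w \<noteq> 0"
proof
  assume 0: "second_focus F w = 0"
  define d where "d = w \<bullet> hom F"
  define s where "s = ((w $ 1)\<^sup>2 + (w $ 2)\<^sup>2 - 1) / d\<^sup>2"
  have "second_focus F w = vector [s * F $ 1 - 2 * w $ 1 / d, s * F $ 2 - 2 * w $ 2 / d, s]"
    by (simp add: second_focus_def Let_def s_def d_def)
  then have "s = 0" "w $ 1 = 0" "w $ 2 = 0"
    using 0 assms by (auto simp: vec_eq_iff forall_3 d_def)
  then show False
    using assms by (simp add: s_def d_def)
qed

text \<open>For eccentricity \<open>1\<close> the second focus is the pole of the line at infinity. Otherwise the conic is symmetric
about the midpoint of the two points, and the point reflection turns a focus equation for \<open>F\<close> into one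
for the second focus.\<close>

lemma second_focus_in_foci:
  assumes "w \<bullet> hom F \<noteq> 0"
  shows "pt (second_focus F w) \<in> foci (con (focal_form F w))"
proof -
  let ?M = "focal_form F w" and ?g = "second_focus F w"
  note dual = focal_dual_inverse[OF assms]
  define d where "d = w \<bullet> hom F"
  define e where "e = (w $ 1)\<^sup>2 + (w $ 2)\<^sup>2"
  have g: "?g = vector [(e - 1) / d\<^sup>2 * F $ 1 - 2 * w $ 1 / d, (e - 1) / d\<^sup>2 * F $ 2 - 2 * w $ 2 / d, (e - 1) / d\<^sup>2]"
    by (simp add: second_focus_def Let_def d_def e_def)
  have d0: "d \<noteq> 0" using assms by (simp add: d_def)
  show ?thesis
  proof (cases "e = 1")
    case True
    then have g3: "?g $ 3 = 0" by (simp add: g)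
    have "focal_dual (hom F) ?g *v axis 3 1 = (1/2) *\<^sub>R ?g"
      using g3 by (simp add: focal_dual_def vec_eq_iff forall_3 matrix_vector_mult_def sum_3 axis_def)
    then have "pt (focal_dual (hom F) ?g *v axis 3 1) = pt ?g"
      using pt_scale[of "1/2", OF _ second_focus_nonzero[OF assms]] by simp
    moreover have "axis 3 1 \<bullet> (focal_dual (hom F) ?g *v axis 3 1) = 0"
      using g3 by (simp add: focal_dual_form inner_axis' axis_3)
    ultimately have "tangent_at (con ?M) line_at_infinity (pt ?g)"
      unfolding infinity_lin by (subst tangent_at_iff_polar[OF dual]) (auto simp: axis_eq_0_iff)
    then show ?thesis by (simp add: foci_def)
  next
    case False
    define l where "l = 2 * d / (1 - e)"
    have l: "l * (1 - e) = 2 * d" using False by (simp add: l_def)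
    define G :: "real^2" where "G = vector [F $ 1 + l * w $ 1, F $ 2 + l * w $ 2]"
    have "((e - 1) / d\<^sup>2) *\<^sub>R hom G = ?g"
      using False d0 unfolding g G_def l_def
      by (simp add: vec_eq_iff forall_3 field_simps power2_eq_square)
    then have pG: "pt ?g = eucl G"
      using False d0 pt_scale[of "(e - 1) / d\<^sup>2" "hom G"] by (simp add: eucl_pt hom_nonzero)
    \<comment> \<open>The image of \<open>w\<close> under the point reflection that exchanges \<open>F\<close> and \<open>G\<close>, up to sign.\<close>
    define w' :: "real^3" where "w' = vector [w $ 1, w $ 2, - d - w $ 1 * G $ 1 - w $ 2 * G $ 2]"
    have w3: "w $ 3 = d - w $ 1 * F $ 1 - w $ 2 * F $ 2"
      by (simp add: d_def inner_vec_def sum_3)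
    have "(dist p F)\<^sup>2 - (w \<bullet> hom p)\<^sup>2 = (dist p G)\<^sup>2 - (w' \<bullet> hom p)\<^sup>2" for p
    proof -
      define x y where "x = p $ 1 - F $ 1" and "y = p $ 2 - F $ 2"
      have a: "w \<bullet> hom p = w $ 1 * x + w $ 2 * y + d"
        by (simp add: inner_vec_def sum_3 w3 x_def y_def algebra_simps)
      have b: "w' \<bullet> hom p = w $ 1 * x + w $ 2 * y - l * e - d"
        by (simp add: inner_vec_def sum_3 w'_def G_def x_def y_def e_def algebra_simps power2_eq_square)
      have c: "(dist p F)\<^sup>2 = x\<^sup>2 + y\<^sup>2" "(dist p G)\<^sup>2 = (x - l * w $ 1)\<^sup>2 + (y - l * w $ 2)\<^sup>2"
        by (simp_all add: dist_sq_plane x_def y_def G_def algebra_simps)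
      have d2: "2 * d = l - l * e" using l by (simp add: algebra_simps)
      define q where "q = w $ 1 * x + w $ 2 * y"
      have "(x - l * w $ 1)\<^sup>2 + (y - l * w $ 2)\<^sup>2 = x\<^sup>2 + y\<^sup>2 - 2 * l * q + l\<^sup>2 * e"
        by (simp add: e_def q_def power2_eq_square algebra_simps)
      moreover have "(q - l * e - d)\<^sup>2 = (q + d)\<^sup>2 - (l * e + 2 * d) * (2 * q - l * e)"
        by (simp add: power2_eq_square algebra_simps)
      ultimately show ?thesis
        unfolding a b c q_def[symmetric] d2 by (simp add: power2_eq_square algebra_simps)
    qed
    then have "focus_equation ?M G"
      unfolding focus_equation_def focal_form_value by (intro exI[of _ 1] exI[of _ w']) auto
    then have "has_focus (con ?M) G"
      using dual_pair_nonzero[OF dual] by (simp add: has_focus_iff)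
    then show ?thesis by (auto simp: foci_def pG)
  qed
qed

text \<open>If \<open>F'\<close> is a focus, the dual form is proportional to \<open>u\<^sub>1\<^sup>2 + u\<^sub>2\<^sup>2\<close> on the lines through \<open>F'\<close>. So the
product \<open>(u \<bullet> f) (u \<bullet> g)\<close> of real linear forms in the normal vector is a multiple of a definite form,
which forces it to vanish: \<open>F'\<close> is one of the two points.\<close>

lemma foci_focal_form:
  assumes "w \<bullet> hom F \<noteq> 0"
  shows "foci (con (focal_form F w)) = {eucl F, pt (second_focus F w)}"
proof
  let ?M = "focal_form F w" and ?g = "second_focus F w"
  note dual = focal_dual_inverse[OF assms]
  have "focus_equation ?M F"
    unfolding focus_equation_def focal_form_value by (intro exI[of _ 1] exI[of _ w]) auto
  then have "eucl F \<in> foci (con ?M)"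
    using dual_pair_nonzero[OF dual] by (simp add: foci_def has_focus_iff)
  with second_focus_in_foci[OF assms] show "{eucl F, pt ?g} \<subseteq> foci (con ?M)"
    by simp
  show "foci (con ?M) \<subseteq> {eucl F, pt ?g}"
  proof
    fix p
    assume "p \<in> foci (con ?M)"
    then consider "tangent_at (con ?M) line_at_infinity p" | F' where "has_focus (con ?M) F'" "p = eucl F'"
      by (auto simp: foci_def)
    then show "p \<in> {eucl F, pt ?g}"
    proof cases
      case 1
      then have *: "axis 3 1 \<bullet> (focal_dual (hom F) ?g *v axis 3 1) = 0" "p = pt (focal_dual (hom F) ?g *v axis 3 1)"
        unfolding infinity_lin by (auto simp: tangent_at_iff_polar[OF dual] axis_eq_0_iff)
      then have g3: "?g $ 3 = 0"
        by (simp add: focal_dual_form inner_axis' axis_3)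
      have "focal_dual (hom F) ?g *v axis 3 1 = (1/2) *\<^sub>R ?g"
        using g3 by (simp add: focal_dual_def vec_eq_iff forall_3 matrix_vector_mult_def sum_3 axis_def)
      then have "p = pt ?g"
        using pt_scale[of "1/2", OF _ second_focus_nonzero[OF assms]] *(2) by simp
      then show ?thesis by simp
    next
      case 2
      obtain w' where w': "con ?M = con (focal_form F' w')" "w' \<bullet> hom F' \<noteq> 0"
        using focal_form_con[OF dual_pair_nondegenerate[OF dual] 2(1)] by metis
      let ?g' = "second_focus F' w'"
      note dual' = focal_dual_inverse[OF w'(2)]
      obtain c where c: "c \<noteq> 0" "focal_form F' w' = c *\<^sub>R ?M"
        using w'(1) Quotient_rel[OF Quotient_conic, of ?M "focal_form F' w'"]
          dual_pair_nonzero[OF dual] dual_pair_nonzero[OF dual']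
        by (auto simp: conic_rel_def proportional_refl) (auto simp: proportional_def)
      have "focal_dual (hom F) ?g *v u = c *\<^sub>R (focal_dual (hom F') ?g' *v u)" for u
        using dual_pair_cancel(1)[OF dual', of u] dual_pair_cancel(2)[OF dual, of "c *\<^sub>R (focal_dual (hom F') ?g' *v u)"]
        by (simp add: c(2) scaleR_matrix_vector_assoc[symmetric] matrix_vector_mult_scaleR)
      then have e: "u \<bullet> (focal_dual (hom F) ?g *v u) = c * (u \<bullet> (focal_dual (hom F') ?g' *v u))" for u
        by simp
      define x y where "x = F' $ 1 - F $ 1" and "y = F' $ 2 - F $ 2"
      define a b where "a = ?g $ 1 - ?g $ 3 * F' $ 1" and "b = ?g $ 2 - ?g $ 3 * F' $ 2"
      \<comment> \<open>Lines through \<open>F'\<close> with normal vector \<open>(r, t)\<close>.\<close>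
      have *: "(1 - c) * (r\<^sup>2 + t\<^sup>2) = (r * x + t * y) * (r * a + t * b)" for r t
      proof -
        define u :: "real^3" where "u = vector [r, t, - r * F' $ 1 - t * F' $ 2]"
        have v: "u \<bullet> hom F' = 0" "u \<bullet> hom F = - (r * x + t * y)" "u \<bullet> ?g = r * a + t * b" "u $ 1 = r" "u $ 2 = t"
          by (simp_all add: u_def inner_vec_def sum_3 x_def y_def a_def b_def algebra_simps)
        have "r * r + t * t + (r * a + t * b) * (- (r * x) - t * y) = c * (r * r + t * t)"
          using e[of u] unfolding focal_dual_form v by simp
        then show ?thesis
          unfolding power2_eq_square by algebra
      qed
      show ?thesis
      proof (cases "F' = F")
        case False
        then have xy: "x\<^sup>2 + y\<^sup>2 \<noteq> 0"
          by (auto simp: x_def y_def vec_eq_iff forall_2 sum_power2_eq_zero_iff)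
        have "c = 1"
        proof -
          \<comment> \<open>Take the line that joins \<open>F\<close> and \<open>F'\<close>.\<close>
          have "(1 - c) * (y\<^sup>2 + x\<^sup>2) = 0"
            using *[of "- y" x] by (simp add: mult.commute)
          with xy show ?thesis by auto
        qed
        then have z: "(r * x + t * y) * (r * a + t * b) = 0" for r t
          using *[of r t] by simp
        have o: "x * a + y * b = 0"
          using z[of x y] xy by (auto simp: power2_eq_square)
        have "((x + a) * x + (y + b) * y) * ((x + a) * a + (y + b) * b) =
            (x\<^sup>2 + y\<^sup>2 + (x * a + y * b)) * ((x * a + y * b) + (a\<^sup>2 + b\<^sup>2))"
          by (simp add: power2_eq_square algebra_simps)
        then have "(x\<^sup>2 + y\<^sup>2) * (a\<^sup>2 + b\<^sup>2) = 0"
          unfolding z o by simp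
        with xy have "a = 0" "b = 0"
          by (auto simp: sum_power2_eq_zero_iff)
        then have g: "?g = ?g $ 3 *\<^sub>R hom F'"
          by (simp add: vec_eq_iff forall_3 a_def b_def)
        moreover have "?g $ 3 \<noteq> 0"
          using g second_focus_nonzero[OF assms] by force
        ultimately have "pt ?g = eucl F'"
          by (metis pt_scale hom_nonzero eucl_pt)
        with 2 show ?thesis by simp
      qed (use 2 in simp)
    qed
  qed
qed

text \<open>Confocal conics share \<open>F\<close> and, up to a factor \<open>\<kappa>\<close>, the coordinates of the second focus.\<close>

lemma confocal_dual:
  assumes "nondegenerate C" "nondegenerate D" "confocal C D"
  obtains M N M' N' \<kappa> where "dual_pair M N" "C = con M" "dual_pair M' N'" "D = con M'" "\<kappa> \<noteq> 0"
    "\<And>u v. u \<bullet> (N' *v v) = \<kappa> * (u \<bullet> (N *v v)) + (1 - \<kappa>) * (u $ 1 * v $ 1 + u $ 2 * v $ 2)"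
proof -
  obtain F where F: "has_focus C F" and foci: "foci C = foci D"
    using assms(3) by (auto simp: confocal_def)
  have "eucl F \<in> foci D"
    using F foci by (auto simp: foci_def)
  then have F': "has_focus D F"
    using eucl_not_at_infinity tangent_at_lies_on[OF assms(2)]
    by (auto simp: foci_def eucl_inj)
  obtain w where w: "C = con (focal_form F w)" "w \<bullet> hom F \<noteq> 0"
    using focal_form_con[OF assms(1) F] .
  obtain w' where w': "D = con (focal_form F w')" "w' \<bullet> hom F \<noteq> 0"
    using focal_form_con[OF assms(2) F'] .
  have "{eucl F, pt (second_focus F w)} = {eucl F, pt (second_focus F w')}"
    using foci w w' foci_focal_form by simp
  then have "pt (second_focus F w) = pt (second_focus F w')"
    by (auto simp: doubleton_eq_iff)
  then obtain \<kappa> where k: "\<kappa> \<noteq> 0" "second_focus F w' = \<kappa> *\<^sub>R second_focus F w"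
    using second_focus_nonzero w(2) w'(2) by (auto simp: pt_eq_iff)
  show ?thesis
  proof (rule that[OF focal_dual_inverse[OF w(2)] w(1) focal_dual_inverse[OF w'(2)] w'(1) k(1)])
    show "u \<bullet> (focal_dual (hom F) (second_focus F w') *v v) =
      \<kappa> * (u \<bullet> (focal_dual (hom F) (second_focus F w) *v v)) + (1 - \<kappa>) * (u $ 1 * v $ 1 + u $ 2 * v $ 2)" for u v
      unfolding focal_dual_form k(2) by (simp add: algebra_simps add_divide_distrib)
  qed
qed

section \<open>Distances from lines\<close>

definition normal_sq :: "real^3 \<Rightarrow> real" where
  "normal_sq u = (u $ 1)\<^sup>2 + (u $ 2)\<^sup>2"

lemma normal_sq_pos:
  assumes "u \<noteq> 0" "lin u \<noteq> line_at_infinity"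
  shows "normal_sq u > 0"
proof (rule ccontr)
  assume "\<not> normal_sq u > 0"
  then have z: "u $ 1 = 0" "u $ 2 = 0"
    by (auto simp: normal_sq_def sum_power2_gt_zero_iff)
  then have u: "u = (u $ 3) *\<^sub>R axis 3 1"
    by (simp add: vec_eq_iff forall_3 axis_3)
  have "u $ 3 \<noteq> 0"
    using assms(1) z by (simp add: vec_eq_iff forall_3)
  then have "lin u = lin (axis 3 1)"
    using lin_scale[of "u $ 3" "axis 3 1"] unfolding u[symmetric] by (simp add: axis_eq_0_iff)
  with assms(2) show False by (simp add: infinity_lin)
qed

lemma line_points_lin: "u \<noteq> 0 \<Longrightarrow> line_points (lin u) = {p. u \<bullet> hom p = 0}"
  by (auto simp: line_points_def eucl_pt lies_on_iff hom_nonzero)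

definition foot :: "real^3 \<Rightarrow> real^2 \<Rightarrow> real^2" where
  "foot u p = p - (u \<bullet> hom p / normal_sq u) *\<^sub>R vector [u $ 1, u $ 2]"

lemma foot_on_line:
  assumes "normal_sq u > 0"
  shows "u \<bullet> hom (foot u p) = 0"
proof -
  define r where "r = u \<bullet> hom p / normal_sq u"
  have "u \<bullet> hom (foot u p) = u \<bullet> hom p - r * normal_sq u"
    unfolding foot_def r_def[symmetric] unfolding normal_sq_def
    by (simp add: inner_vec_def sum_3 power2_eq_square algebra_simps)
  with assms show ?thesis by (simp add: r_def)
qed

text \<open>The theorem of Pythagoras.\<close>

lemma dist_sq_foot:
  assumes "normal_sq u > 0" "u \<bullet> hom q = 0"
  shows "(dist p q)\<^sup>2 = (u \<bullet> hom p)\<^sup>2 / normal_sq u + (dist (foot u p) q)\<^sup>2"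
proof -
  define r where "r = u \<bullet> hom p / normal_sq u"
  have u: "u \<bullet> hom p = u $ 1 * (p $ 1 - q $ 1) + u $ 2 * (p $ 2 - q $ 2)"
    using assms(2) by (simp add: inner_vec_def sum_3 algebra_simps)
  have r: "u \<bullet> hom p = r * normal_sq u" using assms(1) by (simp add: r_def)
  have "(dist (foot u p) q)\<^sup>2 = (p $ 1 - q $ 1 - r * u $ 1)\<^sup>2 + (p $ 2 - q $ 2 - r * u $ 2)\<^sup>2"
    unfolding foot_def r_def[symmetric] dist_sq_plane by (simp add: algebra_simps)
  also have "\<dots> = (dist p q)\<^sup>2 - 2 * r * (u $ 1 * (p $ 1 - q $ 1) + u $ 2 * (p $ 2 - q $ 2)) + r * (r * normal_sq u)"
    unfolding dist_sq_plane normal_sq_def by (simp add: power2_eq_square algebra_simps)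
  also have "\<dots> = (dist p q)\<^sup>2 - r * (u \<bullet> hom p)"
    unfolding u[symmetric] r[symmetric] by simp
  finally show ?thesis
    by (simp add: r_def power2_eq_square)
qed

text \<open>The hypothesis is the shape in which \<open>distance_formula\<close> provides the squared distance \<open>\<rho>\<close>.\<close>

lemma infdist_line:
  assumes "u \<noteq> 0" "normal_sq u > 0" "(u \<bullet> hom p)\<^sup>2 = \<rho> * normal_sq u"
  shows "infdist p (line_points (lin u)) = sqrt \<rho>"
proof (rule antisym)
  have f: "foot u p \<in> line_points (lin u)"
    using assms foot_on_line by (simp add: line_points_lin)
  have d: "(dist p q)\<^sup>2 = \<rho> + (dist (foot u p) q)\<^sup>2" if "q \<in> line_points (lin u)" for q
    using dist_sq_foot[of u q p] assms that by (simp add: line_points_lin)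
  have "dist p (foot u p) = sqrt \<rho>"
    using d[OF f] real_sqrt_unique[of "dist p (foot u p)" \<rho>] by simp
  then show "infdist p (line_points (lin u)) \<le> sqrt \<rho>"
    using infdist_le[OF f, of p] by simp
  have "sqrt \<rho> \<le> dist p q" if "q \<in> line_points (lin u)" for q
    using d[OF that] by (intro real_le_lsqrt) auto
  then show "sqrt \<rho> \<le> infdist p (line_points (lin u))"
    using f unfolding infdist_def by (auto intro!: cINF_greatest)
qed

lemma circle_tangent_line:
  assumes "u \<noteq> 0" "normal_sq u > 0" "r > 0" "(u \<bullet> hom c)\<^sup>2 = r\<^sup>2 * normal_sq u"
  shows "circle_tangent c r (lin u)"
proof -
  have f: "foot u c \<in> line_points (lin u)"
    using assms foot_on_line by (simp add: line_points_lin)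
  have d: "(dist c q)\<^sup>2 = r\<^sup>2 + (dist (foot u c) q)\<^sup>2" if "q \<in> line_points (lin u)" for q
    using dist_sq_foot[of u q c] assms that by (simp add: line_points_lin)
  show ?thesis
    unfolding circle_tangent_def
  proof (rule ex1I[of _ "foot u c"])
    have "dist c (foot u c) = r"
      using d[OF f] assms(3) by simp
    with f show "foot u c \<in> sphere c r \<inter> line_points (lin u)" by simp
    show "q = foot u c" if "q \<in> sphere c r \<inter> line_points (lin u)" for q
      using d[of q] that by auto
  qed
qed

text \<open>The equation \<open>(u \<bullet> z)\<^sup>2 = \<rho> (u\<^sub>1\<^sup>2 + u\<^sub>2\<^sup>2)\<close> prescribes the angle between the normal vector \<open>u\<close> and the
direction \<open>z\<close> up to sign, so there are at most two possible directions of \<open>u\<close>. In the proof, \<open>A u\<close> and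
\<open>B u\<close> are the inner and the outer product of \<open>u\<close> and \<open>z\<close>; the quotient \<open>B u / A u\<close> is determined up
to sign.\<close>

lemma equal_angles_imp_parallel:
  fixes p q r z :: "real^3"
  assumes "\<rho> > 0" "z $ 3 = 0"
    and "(p \<bullet> z)\<^sup>2 = \<rho> * normal_sq p" "(q \<bullet> z)\<^sup>2 = \<rho> * normal_sq q" "(r \<bullet> z)\<^sup>2 = \<rho> * normal_sq r"
    and "normal_sq p > 0" "p $ 1 * q $ 2 \<noteq> p $ 2 * q $ 1" "p $ 1 * r $ 2 \<noteq> p $ 2 * r $ 1"
  shows "q $ 1 * r $ 2 = q $ 2 * r $ 1"
proof -
  define A where "A u = u $ 1 * z $ 1 + u $ 2 * z $ 2" for u :: "real^3"
  define B where "B u = u $ 1 * z $ 2 - u $ 2 * z $ 1" for u :: "real^3"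
  define S where "S = (z $ 1)\<^sup>2 + (z $ 2)\<^sup>2"
  have A: "(A u)\<^sup>2 = \<rho> * normal_sq u" if "(u \<bullet> z)\<^sup>2 = \<rho> * normal_sq u" for u
    using that assms(2) by (simp add: A_def inner_vec_def sum_3)
  have AB: "\<rho> * (B u)\<^sup>2 = (S - \<rho>) * (A u)\<^sup>2" if "(u \<bullet> z)\<^sup>2 = \<rho> * normal_sq u" for u
  proof -
    have "(A u)\<^sup>2 + (B u)\<^sup>2 = S * normal_sq u"
      by (simp add: A_def B_def S_def normal_sq_def power2_eq_square algebra_simps)
    then have "\<rho> * ((A u)\<^sup>2 + (B u)\<^sup>2) = S * (\<rho> * normal_sq u)" by simp
    then show ?thesis using A[OF that] by (simp add: algebra_simps)
  qed
  have cr: "A u * B v - B u * A v = - S * (u $ 1 * v $ 2 - u $ 2 * v $ 1)" for u v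
    by (simp add: A_def B_def S_def power2_eq_square algebra_simps)
  have Ap: "A p \<noteq> 0"
    using A[OF assms(3)] assms(1,6) by auto
  have S0: "S \<noteq> 0"
  proof
    assume "S = 0"
    then have "z $ 1 = 0" "z $ 2 = 0" by (auto simp: S_def sum_power2_eq_zero_iff)
    with Ap show False by (simp add: A_def)
  qed
  have opp: "A p * B v = - (B p * A v)" if "(v \<bullet> z)\<^sup>2 = \<rho> * normal_sq v" "p $ 1 * v $ 2 \<noteq> p $ 2 * v $ 1" for v
  proof -
    have "\<rho> * ((A p * B v - B p * A v) * (A p * B v + B p * A v)) = (A p)\<^sup>2 * (\<rho> * (B v)\<^sup>2) - (\<rho> * (B p)\<^sup>2) * (A v)\<^sup>2"
      by (simp add: power2_eq_square algebra_simps)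
    also have "\<dots> = 0"
      unfolding AB[OF that(1)] AB[OF assms(3)] by simp
    finally have "(A p * B v - B p * A v) * (A p * B v + B p * A v) = 0"
      using assms(1) by simp
    moreover have "A p * B v - B p * A v \<noteq> 0"
      unfolding cr using S0 that(2) by simp
    ultimately show ?thesis by (simp add: add_eq_0_iff)
  qed
  have "A p * (A q * B r - B q * A r) = A q * (A p * B r) - (A p * B q) * A r"
    by (simp add: algebra_simps)
  also have "\<dots> = 0"
    unfolding opp[OF assms(4,7)] opp[OF assms(5,8)] by simp
  finally have "A q * B r - B q * A r = 0" using Ap by simp
  then show ?thesis using S0 unfolding cr by simp
qed

lemma dual_pair_cross:
  assumes "dual_pair M N"
  shows "(M *v x) \<times> (M *v y) = 0 \<longleftrightarrow> x \<times> y = 0"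
proof -
  have *: "(K *v x) \<times> (K *v y) = 0" if "x \<times> y = 0" for K :: "real^3^3" and x y
  proof (cases "x = 0")
    case False
    then obtain c where "y = c *\<^sub>R x" using \<open>x \<times> y = 0\<close> cross_zero_multiple by blast
    then show ?thesis by (simp add: matrix_vector_mult_scaleR cross_mult_right)
  qed simp
  show ?thesis
    using *[of x y M] *[of "M *v x" "M *v y" N] dual_pair_cancel(2)[OF assms] by auto
qed

section \<open>Angle bisectors and inscribed circles\<close>

locale confocal_conics =
  fixes M N M' N' :: "real^3^3" and \<kappa> :: real
  assumes dual: "dual_pair M N" and dual': "dual_pair M' N'" and \<kappa>: "\<kappa> \<noteq> 0"
    and confocal: "u \<bullet> (N' *v v) = \<kappa> * (u \<bullet> (N *v v)) + (1 - \<kappa>) * (u $ 1 * v $ 1 + u $ 2 * v $ 2)"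
begin

text \<open>\<open>u\<close> and \<open>v\<close> are the two tangents of the conic \<open>M\<close> from a point of the conic \<open>M'\<close>; both are
lines of the Euclidean plane.\<close>

definition tangents_on :: "real^3 \<Rightarrow> real^3 \<Rightarrow> bool" where
  "tangents_on u v \<longleftrightarrow> u \<times> v \<noteq> 0 \<and> u \<bullet> (N *v u) = 0 \<and> v \<bullet> (N *v v) = 0 \<and>
    normal_sq u > 0 \<and> normal_sq v > 0 \<and> (u \<times> v) \<bullet> (M' *v (u \<times> v)) = 0"

lemma tangents_on_cases:
  assumes "tangents_on u v" "w \<in> {u, v}"
  shows "w \<bullet> (u \<times> v) = 0" "w \<bullet> (N *v w) = 0" "normal_sq w > 0" "w \<noteq> 0" "u \<times> v \<noteq> 0"
    "(u \<times> v) \<bullet> (M' *v (u \<times> v)) = 0"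
  using assms by (auto simp: tangents_on_def dot_cross_self normal_sq_def)

lemma distance_to_tangents:
  assumes "tangents_on u v" "w \<in> {u, v}" "z \<bullet> (M' *v (u \<times> v)) = 0"
  shows "(w \<bullet> z)\<^sup>2 = (1 - \<kappa>) * (z \<bullet> (M' *v z)) * normal_sq w"
proof -
  note t = tangents_on_cases[OF assms(1,2)]
  have "(w \<bullet> z)\<^sup>2 = (z \<bullet> (M' *v z)) * (w \<bullet> (N' *v w))"
    using t assms(3) by (intro distance_formula[OF dual']) auto
  then show ?thesis
    using t by (simp add: confocal normal_sq_def power2_eq_square)
qed

text \<open>If the tangent of \<open>M'\<close> at \<open>u \<times> v\<close> were the line at infinity, both conics would be parabolas touching
it at this point. A point of \<open>M\<close> lies on only one tangent of \<open>M\<close>, but here it would also lie on \<open>u\<close>.\<close>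

lemma polar_not_infinity:
  assumes "tangents_on u v"
  shows "lin (M' *v (u \<times> v)) \<noteq> line_at_infinity"
proof
  let ?x = "u \<times> v"
  note t = tangents_on_cases[OF assms insertI1]
  assume "lin (M' *v ?x) = line_at_infinity"
  moreover have "M' *v ?x \<noteq> 0"
    using t dual_pair_eq_0[OF dual'] by simp
  ultimately obtain c where c: "c \<noteq> 0" "axis 3 1 = c *\<^sub>R (M' *v ?x)"
    by (auto simp: infinity_lin lin_eq_iff axis_eq_0_iff)
  then have x: "N' *v axis 3 1 = c *\<^sub>R ?x"
    by (simp add: matrix_vector_mult_scaleR dual_pair_cancel[OF dual'])
  have "u \<bullet> (N' *v axis 3 1) = 0"
    unfolding x using t by simp
  then have 1: "u \<bullet> (N *v axis 3 1) = 0"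
    using \<kappa> by (simp add: confocal axis_3)
  have "axis 3 1 \<bullet> (N' *v axis 3 1) = 0"
    unfolding x using t(6) by (simp add: c(2) inner_commute)
  then have 2: "axis 3 1 \<bullet> (N *v axis 3 1) = 0"
    using \<kappa> by (simp add: confocal axis_3)
  have "u \<times> axis 3 1 = 0"
    by (rule isotropic_orthogonal_proportional[OF dual_pair_sym[OF dual] t(2) 2 1])
  then have "u $ 1 = 0" "u $ 2 = 0"
    by (simp_all add: cross3_def vec_eq_iff forall_3 axis_3)
  with t show False by (simp add: normal_sq_def)
qed

lemma tangents_on_bisector:
  assumes "tangents_on u v"
  shows "angle_bisector (lin (M' *v (u \<times> v))) (lin u) (lin v)"
  unfolding angle_bisector_def
proof (intro conjI ballI polar_not_infinity assms)
  fix p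
  assume "p \<in> line_points (lin (M' *v (u \<times> v)))"
  moreover have "M' *v (u \<times> v) \<noteq> 0"
    using tangents_on_cases[OF assms insertI1] dual_pair_eq_0[OF dual'] by simp
  ultimately have p: "hom p \<bullet> (M' *v (u \<times> v)) = 0"
    by (simp add: line_points_lin inner_commute)
  have "infdist p (line_points (lin w)) = sqrt ((1 - \<kappa>) * (hom p \<bullet> (M' *v hom p)))" if "w \<in> {u, v}" for w
    using tangents_on_cases[OF assms that] distance_to_tangents[OF assms that p] by (intro infdist_line)
  then show "infdist p (line_points (lin u)) = infdist p (line_points (lin v))" by simp
qed

text \<open>For \<open>\<kappa> = 1\<close> the conics coincide, and from a point of a conic there are no two tangents.\<close>

lemma kappa_neq_1:
  assumes "tangents_on u v"
  shows "\<kappa> \<noteq> 1"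
proof
  assume k: "\<kappa> = 1"
  define h where "h = M' *v (u \<times> v)"
  note t = tangents_on_cases[OF assms]
  have h: "h \<noteq> 0"
    using t(5)[OF insertI1] dual_pair_eq_0[OF dual'] by (simp add: h_def)
  have "\<exists>c. c \<noteq> 0 \<and> w = c *\<^sub>R h" if w: "w \<in> {u, v}" for w
  proof (rule line_eqI[OF h])
    show "w \<noteq> 0" using t[OF w] by simp
    show "w \<bullet> y = 0" if "h \<bullet> y = 0" for y
      using distance_to_tangents[OF assms w, of y] that by (simp add: k h_def inner_commute)
  qed
  then obtain c d where "u = c *\<^sub>R h" "v = d *\<^sub>R h" by blast
  then have "u \<times> v = 0" by (simp add: cross_mult_left cross_mult_right)
  with assms show False by (simp add: tangents_on_def)
qed

lemma tangents_on_lines: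
  assumes "u \<noteq> 0" "v \<noteq> 0" "lin u \<noteq> lin v" "lin u \<noteq> line_at_infinity" "lin v \<noteq> line_at_infinity"
    and "tangent (con M) (lin u)" "tangent (con M) (lin v)" "on_conic (con M') (meet (lin u) (lin v))"
  shows "tangents_on u v"
proof -
  have x: "u \<times> v \<noteq> 0"
    using assms by (simp add: lin_eq_cross)
  then have "(u \<times> v) \<bullet> (M' *v (u \<times> v)) = 0"
    using assms by (simp add: meet_lin on_conic_iff[OF dual'])
  then show ?thesis
    using assms x by (simp add: tangents_on_def tangent_iff[OF dual] normal_sq_pos)
qed

lemma polar_eq_iff:
  assumes "x \<noteq> 0" "y \<noteq> 0"
  shows "lin (M' *v x) = lin (M' *v y) \<longleftrightarrow> pt x = pt y"
  using assms dual_pair_eq_0[OF dual'] by (simp add: lin_eq_cross pt_eq_cross dual_pair_cross[OF dual'])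

lemma polar_tangent:
  assumes "x \<noteq> 0" "x \<bullet> (M' *v x) = 0"
  shows "tangent (con M') (lin (M' *v x))"
  using assms dual_pair_eq_0[OF dual']
  by (simp add: tangent_iff[OF dual'] dual_pair_cancel[OF dual'] inner_commute)

text \<open>Let \<open>x\<close>, \<open>y\<close> be the two points of \<open>M'\<close> and \<open>z\<close> the common point of the tangents there. By
\<open>distance_to_tangents\<close> it has the same distance from the four lines. What remains is that this distance
is positive, since only one tangent of \<open>M'\<close> passes through a point of \<open>M'\<close>, and that \<open>z\<close> is a point
of the Euclidean plane.\<close>

lemma circle_centre:
  assumes a: "tangents_on u u'" and b: "tangents_on v v'"
    and distinct: "(u \<times> u') \<times> (v \<times> v') \<noteq> 0"
    and finite: "\<And>p q. p \<in> {u, u'} \<Longrightarrow> q \<in> {v, v'} \<Longrightarrow> (p \<times> q) $ 3 \<noteq> 0"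
  shows "lin (M' *v (u \<times> u')) \<noteq> lin (M' *v (v \<times> v'))"
    and "\<exists>c r. inscribed_circle c r (lin u) (lin v) (lin u') (lin v') \<and>
      meet (lin (M' *v (u \<times> u'))) (lin (M' *v (v \<times> v'))) = eucl c"
proof -
  define x where "x = u \<times> u'"
  define y where "y = v \<times> v'"
  define z where "z = (M' *v x) \<times> (M' *v y)"
  note ta = tangents_on_cases[OF a, folded x_def] and tb = tangents_on_cases[OF b, folded y_def]
  have xy: "x \<times> y \<noteq> 0" using distinct by (simp add: x_def y_def)
  then have z: "z \<noteq> 0" by (simp add: z_def dual_pair_cross[OF dual'])
  have k: "M' *v x \<noteq> 0" "M' *v y \<noteq> 0"
    using ta(5)[OF insertI1] tb(5)[OF insertI1] dual_pair_eq_0[OF dual'] by simp_all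
  show "lin (M' *v (u \<times> u')) \<noteq> lin (M' *v (v \<times> v'))"
    using z k by (simp add: lin_eq_cross z_def x_def y_def)
  have zx: "z \<bullet> (M' *v x) = 0" and zy: "z \<bullet> (M' *v y) = 0"
    by (simp_all add: z_def dot_cross_self)
  have zz: "z \<bullet> (M' *v z) \<noteq> 0"
  proof
    assume 0: "z \<bullet> (M' *v z) = 0"
    have "z \<times> x = 0"
      by (rule isotropic_orthogonal_proportional[OF dual' 0 ta(6)[OF insertI1] zx])
    moreover have "z \<times> y = 0"
      by (rule isotropic_orthogonal_proportional[OF dual' 0 tb(6)[OF insertI1] zy])
    ultimately obtain r s where "x = r *\<^sub>R z" "y = s *\<^sub>R z"
      using z cross_zero_multiple by metis
    with xy show False by (simp add: cross_mult_left cross_mult_right)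
  qed
  define \<rho> where "\<rho> = (1 - \<kappa>) * (z \<bullet> (M' *v z))"
  have d: "(w \<bullet> z)\<^sup>2 = \<rho> * normal_sq w" "normal_sq w > 0" "w \<noteq> 0" if "w \<in> {u, u', v, v'}" for w
    using that distance_to_tangents[OF a _ zx[unfolded x_def], of w] ta[of w]
      distance_to_tangents[OF b _ zy[unfolded y_def], of w] tb[of w]
    by (auto simp: \<rho>_def)
  have "\<rho> * normal_sq u \<ge> 0"
    using d(1)[of u] zero_le_power2[of "u \<bullet> z"] by simp
  then have "\<rho> \<ge> 0"
    using d(2)[of u] by (simp add: zero_le_mult_iff)
  moreover have "\<rho> \<noteq> 0"
    using zz kappa_neq_1[OF a] by (simp add: \<rho>_def)
  ultimately have \<rho>: "\<rho> > 0" by simp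
  have z3: "z $ 3 \<noteq> 0"
  proof
    assume z3: "z $ 3 = 0"
    have np: "p $ 1 * q $ 2 \<noteq> p $ 2 * q $ 1" "q $ 1 * p $ 2 \<noteq> q $ 2 * p $ 1" if "p \<in> {u, u'}" "q \<in> {v, v'}" for p q
      using finite[OF that] by (auto simp: cross3_def mult.commute)
    \<comment> \<open>If \<open>z\<close> were at infinity, all four lines would make the same angle with its direction. As \<open>u\<close> and \<open>u'\<close>
      are not parallel to \<open>v\<close> and \<open>v'\<close>, both pairs would consist of parallel lines. Then \<open>x\<close> and \<open>z\<close> would be
      points at infinity, and the line \<open>M' *v x\<close> through them would be the line at infinity.\<close>
    have "v $ 1 * v' $ 2 = v $ 2 * v' $ 1"
      by (rule equal_angles_imp_parallel[OF \<rho> z3, of u]) (use d np(1)[of u v] np(1)[of u v'] in auto)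
    have "u $ 1 * u' $ 2 = u $ 2 * u' $ 1"
      by (rule equal_angles_imp_parallel[OF \<rho> z3, of v]) (use d np(2)[of u v] np(2)[of u' v] in auto)
    then have x3: "x $ 3 = 0"
      by (simp add: x_def cross3_def)
    have xz0: "x \<times> z \<noteq> 0"
    proof
      assume "x \<times> z = 0"
      then obtain c where "z = c *\<^sub>R x" using ta(5)[OF insertI1] cross_zero_multiple by blast
      with zx have "z \<bullet> (M' *v z) = 0" by (simp add: matrix_vector_mult_scaleR)
      with zz show False by simp
    qed
    obtain c where c: "M' *v x = c *\<^sub>R (x \<times> z)"
      using orthogonal_both[OF xz0, of "M' *v x"] zx ta(6)[OF insertI1] by (auto simp: inner_commute)
    have "x \<times> z = ((x \<times> z) $ 3) *\<^sub>R axis 3 1"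
      using x3 z3 by (simp add: cross3_def vec_eq_iff forall_3 axis_3)
    with c have "M' *v x = (c * (x \<times> z) $ 3) *\<^sub>R axis 3 1"
      by (metis scaleR_scaleR)
    moreover from this have "c * (x \<times> z) $ 3 \<noteq> 0" using k by auto
    ultimately have "lin (M' *v x) = line_at_infinity"
      by (simp add: infinity_lin lin_scale axis_eq_0_iff del: mult_eq_0_iff)
    with polar_not_infinity[OF a] show False by (simp add: x_def)
  qed
  define c :: "real^2" where "c = vector [z $ 1 / z $ 3, z $ 2 / z $ 3]"
  have hc: "hom c = (1 / z $ 3) *\<^sub>R z"
    using z3 by (simp add: vec_eq_iff forall_3 c_def)
  define r where "r = sqrt \<rho> / \<bar>z $ 3\<bar>"
  have r: "r > 0" "r\<^sup>2 = \<rho> / (z $ 3)\<^sup>2"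
    using \<rho> z3 by (simp_all add: r_def power_divide)
  have "circle_tangent c r (lin w)" if "w \<in> {u, u', v, v'}" for w
    using d[OF that] r
    by (intro circle_tangent_line) (auto simp: hc power_divide)
  then have "inscribed_circle c r (lin u) (lin v) (lin u') (lin v')"
    using r by (auto simp: inscribed_circle_def)
  moreover have "meet (lin (M' *v x)) (lin (M' *v y)) = eucl c"
    using z z3 k by (simp add: meet_lin z_def[symmetric] eucl_pt hc pt_scale)
  ultimately show "\<exists>c r. inscribed_circle c r (lin u) (lin v) (lin u') (lin v') \<and>
      meet (lin (M' *v (u \<times> u'))) (lin (M' *v (v \<times> v'))) = eucl c"
    unfolding x_def y_def by blast
qed

end

section \<open>Projective coordinates on a line\<close>

text \<open>\<open>p\<close> has the coordinate \<open>s\<close> on the line \<open>V W\<close> if \<open>V\<close>, \<open>W\<close>, \<open>T\<close> have the coordinates \<open>0\<close>, \<open>\<infinity>\<close>, \<open>1\<close>.\<close>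

definition frame_coord :: "ppoint \<Rightarrow> ppoint \<Rightarrow> ppoint \<Rightarrow> real \<Rightarrow> ppoint \<Rightarrow> bool" where
  "frame_coord V W T s p \<longleftrightarrow> (\<exists>v w. v \<times> w \<noteq> 0 \<and> V = pt v \<and> W = pt w \<and> T = pt (v + w) \<and>
     p = pt (v + s *\<^sub>R w))"

lemma cross_independent:
  fixes v w :: "real^3"
  assumes "v \<times> w \<noteq> 0"
  shows "a *\<^sub>R v + b *\<^sub>R w = 0 \<longleftrightarrow> a = 0 \<and> b = 0" "v \<noteq> 0" "w \<noteq> 0"
proof -
  have "a = 0 \<and> b = 0" if "a *\<^sub>R v + b *\<^sub>R w = 0"
  proof -
    have "(a *\<^sub>R v + b *\<^sub>R w) \<times> w = a *\<^sub>R (v \<times> w)" "v \<times> (a *\<^sub>R v + b *\<^sub>R w) = b *\<^sub>R (v \<times> w)"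
      by (simp_all add: cross_add_left cross_add_right cross_mult_left cross_mult_right)
    then have "a *\<^sub>R (v \<times> w) = 0" "b *\<^sub>R (v \<times> w) = 0"
      unfolding that by simp_all
    with assms show ?thesis by simp
  qed
  then show "a *\<^sub>R v + b *\<^sub>R w = 0 \<longleftrightarrow> a = 0 \<and> b = 0" by auto
  show "v \<noteq> 0" "w \<noteq> 0" using assms by auto
qed

lemma cross_independent_1:
  fixes v w :: "real^3"
  assumes "v \<times> w \<noteq> 0"
  shows "v + b *\<^sub>R w \<noteq> 0" "v + w \<noteq> 0"
  using cross_independent(1)[OF assms, of 1 b] cross_independent(1)[OF assms, of 1 1] by auto

text \<open>Representatives of \<open>V\<close> and \<open>W\<close> whose sum represents \<open>T\<close> are unique up to a common factor, which makes
the coordinate independent of the choice.\<close>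

lemma frame_unique:
  assumes "v \<times> w \<noteq> 0" "v' \<times> w' \<noteq> 0" "pt v = pt v'" "pt w = pt w'" "pt (v + w) = pt (v' + w')"
  shows "\<exists>c. c \<noteq> 0 \<and> v' = c *\<^sub>R v \<and> w' = c *\<^sub>R w"
proof -
  note n = cross_independent(2,3)[OF assms(1)] cross_independent(2,3)[OF assms(2)]
  obtain a where a: "a \<noteq> 0" "v' = a *\<^sub>R v"
    using assms(3) n by (auto simp: pt_eq_iff)
  obtain b where b: "b \<noteq> 0" "w' = b *\<^sub>R w"
    using assms(4) n by (auto simp: pt_eq_iff)
  obtain c where c: "c \<noteq> 0" "v' + w' = c *\<^sub>R (v + w)"
    using assms(5) cross_independent_1[OF assms(1)] cross_independent_1[OF assms(2)]
    by (auto simp: pt_eq_iff)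
  have "(a - c) *\<^sub>R v + (b - c) *\<^sub>R w = 0"
    using c(2) by (simp add: a b algebra_simps)
  then have "a = c" "b = c"
    using cross_independent(1)[OF assms(1)] by auto
  with a b show ?thesis by auto
qed

lemma frame_coord_iff:
  assumes "v \<times> w \<noteq> 0"
  shows "frame_coord (pt v) (pt w) (pt (v + w)) s p \<longleftrightarrow> p = pt (v + s *\<^sub>R w)"
proof
  assume "frame_coord (pt v) (pt w) (pt (v + w)) s p"
  then obtain v' w' where *: "v' \<times> w' \<noteq> 0" "pt v = pt v'" "pt w = pt w'" "pt (v + w) = pt (v' + w')" "p = pt (v' + s *\<^sub>R w')"
    by (auto simp: frame_coord_def)
  obtain c where "c \<noteq> 0" "v' = c *\<^sub>R v" "w' = c *\<^sub>R w"
    using frame_unique[OF assms *(1-4)] by auto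
  then have "v' + s *\<^sub>R w' = c *\<^sub>R (v + s *\<^sub>R w)"
    by (simp add: algebra_simps)
  then show "p = pt (v + s *\<^sub>R w)"
    using * \<open>c \<noteq> 0\<close> cross_independent_1[OF assms] by (simp add: pt_scale)
qed (use assms in \<open>auto simp: frame_coord_def\<close>)

lemma frame_coord_unique:
  assumes "frame_coord V W T s p" "frame_coord V W T t p"
  shows "s = t"
proof -
  obtain v w where *: "v \<times> w \<noteq> 0" "V = pt v" "W = pt w" "T = pt (v + w)"
    using assms(1) by (auto simp: frame_coord_def)
  have "pt (v + s *\<^sub>R w) = pt (v + t *\<^sub>R w)"
    using assms unfolding *(2-4) frame_coord_iff[OF *(1)] by simp
  then obtain c where "c \<noteq> 0" "v + t *\<^sub>R w = c *\<^sub>R (v + s *\<^sub>R w)"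
    using cross_independent_1[OF *(1)] by (auto simp: pt_eq_iff)
  then have "(1 - c) *\<^sub>R v + (t - c * s) *\<^sub>R w = 0"
    by (simp add: algebra_simps)
  then show ?thesis
    using cross_independent(1)[OF *(1)] by auto
qed

lemma frame_coord_swap:
  assumes "s \<noteq> 0" "frame_coord V W T s p"
  shows "frame_coord W V T (inverse s) p"
proof -
  obtain v w where *: "v \<times> w \<noteq> 0" "V = pt v" "W = pt w" "T = pt (v + w)" "p = pt (v + s *\<^sub>R w)"
    using assms(2) by (auto simp: frame_coord_def)
  have "w \<times> v \<noteq> 0"
    using *(1) cross_skew[of v w] by auto
  moreover have "w + inverse s *\<^sub>R v = inverse s *\<^sub>R (v + s *\<^sub>R w)"
    using assms(1) by (simp add: scaleR_add_right)
  then have "p = pt (w + inverse s *\<^sub>R v)"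
    using * assms(1) cross_independent_1[OF *(1)] by (simp add: pt_scale)
  ultimately show ?thesis
    using * unfolding frame_coord_def by (intro exI[of _ w] exI[of _ v]) (auto simp: add.commute)
qed

lemma frame_coord_swap_iff:
  "s \<noteq> 0 \<Longrightarrow> frame_coord W V T (inverse s) p \<longleftrightarrow> frame_coord V W T s p"
  using frame_coord_swap[of s V W T p] frame_coord_swap[of "inverse s" W V T p] by auto

lemma frame_coord_exists:
  assumes "frame_coord V W T s0 p0" "V lies_on L" "W lies_on L" "p lies_on L" "p \<noteq> V" "p \<noteq> W"
  obtains s where "s \<noteq> 0" "frame_coord V W T s p"
proof -
  obtain v w where *: "v \<times> w \<noteq> 0" "V = pt v" "W = pt w" "T = pt (v + w)"
    using assms(1) by (auto simp: frame_coord_def)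
  obtain x where x: "x \<noteq> 0" "p = pt x" by (rule pt_cases)
  obtain u where u: "u \<noteq> 0" "L = lin u" by (rule lin_cases)
  have "u \<bullet> v = 0" "u \<bullet> w = 0" "u \<bullet> x = 0"
    using assms x u * cross_independent(2,3)[OF *(1)] by (auto simp: lies_on_iff)
  then obtain c where "u = c *\<^sub>R (v \<times> w)"
    using orthogonal_both[OF *(1), of u] by auto
  then have "x \<bullet> (v \<times> w) = 0"
    using \<open>u \<bullet> x = 0\<close> u(1) by (auto simp: inner_commute)
  then obtain a b where ab: "x = a *\<^sub>R v + b *\<^sub>R w"
    using orthogonal_cross_combination *(1) by metis
  have "a \<noteq> 0"
    using ab x assms(6) * cross_independent(2,3)[OF *(1)] by (auto simp: pt_scale)
  have "b \<noteq> 0"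
    using ab x assms(5) * cross_independent(2,3)[OF *(1)] by (auto simp: pt_scale)
  have "x = a *\<^sub>R (v + (b / a) *\<^sub>R w)"
    using \<open>a \<noteq> 0\<close> by (simp add: ab scaleR_add_right)
  then have "p = pt (v + (b / a) *\<^sub>R w)"
    using x \<open>a \<noteq> 0\<close> cross_independent_1[OF *(1)] by (simp add: pt_scale)
  with * \<open>a \<noteq> 0\<close> \<open>b \<noteq> 0\<close> that[of "b / a"] show ?thesis
    by (simp add: frame_coord_iff)
qed

section \<open>Conics inscribed in a quadrilateral\<close>

text \<open>A point of a conic lies on only one tangent. So a vertex of a quadrilateral formed by tangents is never a
tangency point.\<close>

lemma tangent_through_tangency_point:
  assumes "nondegenerate Q" "tangent_at Q e p" "tangent Q e'" "p lies_on e'"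
  shows "e' = e"
proof -
  obtain M N where MN: "dual_pair M N" and Q: "Q = con M"
    using assms(1) by (rule nondegenerate_cases)
  obtain u where u: "u \<noteq> 0" "e = lin u" by (rule lin_cases)
  obtain v where v: "v \<noteq> 0" "e' = lin v" by (rule lin_cases)
  have Nu: "N *v u \<noteq> 0"
    using MN u dual_pair_eq_0 dual_pair_sym by blast
  have 1: "u \<bullet> (N *v u) = 0" "p = pt (N *v u)"
    using assms(2) u Q by (auto simp: tangent_at_iff_polar[OF MN])
  have 2: "v \<bullet> (N *v v) = 0"
    using assms(3) v Q by (simp add: tangent_iff[OF MN])
  have "v \<bullet> (N *v u) = 0"
    using assms(4) 1 Nu v by (simp add: lies_on_iff)
  then have "v \<times> u = 0"
    using isotropic_orthogonal_proportional[OF dual_pair_sym[OF MN] 2 1(1)] by blast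
  then show ?thesis
    using u v by (simp add: lin_eq_cross)
qed

lemma meet_lies_on: "k \<noteq> l \<Longrightarrow> meet k l lies_on k" "k \<noteq> l \<Longrightarrow> meet k l lies_on l"
  using lies_on_both_iff_meet by blast+

lemma generic_inscribed:
  assumes "generic k l k' l'" "nondegenerate Q" "\<forall>e\<in>{k, l, k', l'}. tangent Q e"
  shows "inscribed_conic Q k l k' l'"
proof -
  have d: "distinct [k, l, k', l']" using assms(1) by (simp add: generic_def)
  have "p \<notin> vertices k l k' l'" if e: "e \<in> {k, l, k', l'}" and p: "tangent_at Q e p" for e p
  proof
    assume "p \<in> vertices k l k' l'"
    then obtain f g where fg: "f \<in> {k, l, k', l'}" "g \<in> {k, l, k', l'}" "f \<noteq> g" "p = meet f g"
      using d by (auto simp: vertices_def)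
    then have "f = e" "g = e"
      using tangent_through_tangency_point[OF assms(2) p] assms(3) meet_lies_on[OF fg(3)] by blast+
    with fg show False by simp
  qed
  then show ?thesis
    using assms by (auto simp: inscribed_conic_def tangent_def)
qed

lemma double_line_degenerate: "\<not> nondegenerate (double_line h)"
proof -
  obtain u where u: "u \<noteq> 0" "h = lin u" by (rule lin_cases)
  let ?M = "\<chi> i j. u $ i * u $ j"
  have "?M \<noteq> 0"
    using u by (auto simp: vec_eq_iff)
  moreover have "transpose ?M = ?M"
    by (simp add: transpose_def vec_eq_iff mult.commute)
  moreover have "det ?M = 0"
    by (simp add: det_3 algebra_simps)
  ultimately show ?thesis
    using u by (simp add: double_line_ln nondegenerate_iff)
qed

lemma double_line_inj: "double_line g = double_line h \<longleftrightarrow> g = h"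
proof
  assume eq: "double_line g = double_line h"
  obtain u where u: "u \<noteq> 0" "g = lin u" by (rule lin_cases)
  obtain v where v: "v \<noteq> 0" "h = lin v" by (rule lin_cases)
  have "conic_rel (\<chi> i j. u $ i * u $ j) (\<chi> i j. v $ i * v $ j)"
    if "(\<chi> i j. u $ i * u $ j) \<noteq> 0" "(\<chi> i j. v $ i * v $ j) \<noteq> 0"
    using eq that u v Quotient_rel[OF Quotient_conic, of "\<chi> i j. u $ i * u $ j" "\<chi> i j. v $ i * v $ j"]
    by (auto simp: double_line_ln conic_rel_def proportional_refl transpose_def vec_eq_iff mult.commute)
  moreover have "(\<chi> i j. u $ i * u $ j) \<noteq> 0" "(\<chi> i j. v $ i * v $ j) \<noteq> 0"
    using u v by (auto simp: vec_eq_iff)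
  ultimately obtain c where "(\<chi> i j. v $ i * v $ j) = c *\<^sub>R (\<chi> i j. u $ i * u $ j)"
    by (auto simp: conic_rel_def proportional_def)
  then have c: "v $ i * v $ j = c * (u $ i * u $ j)" for i j
    by (simp add: vec_eq_iff)
  have "(u $ i * v $ j - u $ j * v $ i)\<^sup>2 = 0" for i j
  proof -
    have "(u $ i * v $ j - u $ j * v $ i)\<^sup>2 = u $ i * u $ i * (v $ j * v $ j) + u $ j * u $ j * (v $ i * v $ i) - 2 * (u $ i * u $ j) * (v $ i * v $ j)"
      by (simp add: power2_eq_square algebra_simps)
    then show ?thesis
      unfolding c by (simp add: algebra_simps)
  qed
  then have "u $ i * v $ j = u $ j * v $ i" for i j by simp
  then have "u \<times> v = 0"
    by (simp add: cross3_def vec_eq_iff forall_3)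
  with u v show "g = h" by (simp add: lin_eq_cross)
qed simp

lemma tangency_point_nondegenerate:
  "nondegenerate Q \<Longrightarrow> tangency_point Q e p \<longleftrightarrow> tangent_at Q e p"
  by (auto simp: tangency_point_def double_line_degenerate)

lemma tangency_point_double_line:
  "tangency_point (double_line h) e p \<longleftrightarrow> p lies_on h \<and> p lies_on e"
  by (auto simp: tangency_point_def double_line_degenerate double_line_inj)

text \<open>The lines \<open>u1\<close>, \<open>u2\<close>, \<open>u3\<close> are the sides of a triangle with vertices \<open>e1\<close>, \<open>e2\<close>, \<open>e3\<close>. The
quadrilateral considered below has the consecutive edge-lines \<open>u1\<close>, \<open>u2\<close>, \<open>u3\<close>, \<open>u1 + u2 + u3\<close>, which is a normal
form for generic lines (\<open>generic_normal_form\<close>).\<close>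

locale dual_bases =
  fixes u1 u2 u3 e1 e2 e3 :: "real^3"
  assumes dual [simp]: "u1 \<bullet> e1 = 1" "u1 \<bullet> e2 = 0" "u1 \<bullet> e3 = 0" "u2 \<bullet> e1 = 0" "u2 \<bullet> e2 = 1" "u2 \<bullet> e3 = 0"
    "u3 \<bullet> e1 = 0" "u3 \<bullet> e2 = 0" "u3 \<bullet> e3 = 1"
    and expand_point: "x = (u1 \<bullet> x) *\<^sub>R e1 + (u2 \<bullet> x) *\<^sub>R e2 + (u3 \<bullet> x) *\<^sub>R e3"
begin

lemma expand_line: "u = (u \<bullet> e1) *\<^sub>R u1 + (u \<bullet> e2) *\<^sub>R u2 + (u \<bullet> e3) *\<^sub>R u3" (is "u = ?v")
proof -
  have "u \<bullet> x = ?v \<bullet> x" for x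
    by (subst (1) expand_point[of x]) (simp add: inner_add_left inner_add_right)
  then show ?thesis
    by (rule iffD1[OF vector_eq_rdot, OF allI])
qed

abbreviation u4 where "u4 \<equiv> u1 + u2 + u3"

lemma nonzero: "u1 \<noteq> 0" "u2 \<noteq> 0" "u3 \<noteq> 0" "u4 \<noteq> 0" "e1 \<noteq> 0" "e2 \<noteq> 0" "e3 \<noteq> 0" "u1 + u3 \<noteq> 0" "e1 - e3 \<noteq> 0"
proof -
  have "u4 \<bullet> e1 = 1" "(u1 + u3) \<bullet> e1 = 1" "u1 \<bullet> (e1 - e3) = 1" by (simp_all add: inner_add_left inner_diff_right)
  then show "u4 \<noteq> 0" "u1 + u3 \<noteq> 0" "e1 - e3 \<noteq> 0" by fastforce+
qed (use dual in fastforce)+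

text \<open>A dual form that vanishes at \<open>u1\<close>, \<open>u2\<close>, \<open>u3\<close> has in the coordinates with respect to these lines only
mixed coefficients \<open>c\<close>, \<open>b\<close>, \<open>a\<close> (of the first two, of the first and the third, of the last two
coordinates), and it vanishes at the fourth line if and only if \<open>a + b + c = 0\<close>. The zeros of \<open>a\<close> and \<open>c\<close> give the
pairs of opposite vertices, so the remaining members are normalised by \<open>c = 1\<close>, \<open>a = t\<close>,
\<open>b = - (1 + t)\<close> with \<open>t \<noteq> 0\<close>.\<close>

definition conic_dual :: "real \<Rightarrow> real^3^3" where
  "conic_dual t = (\<chi> i j. (e1 $ i * e2 $ j + e2 $ i * e1 $ j) - (1 + t) * (e1 $ i * e3 $ j + e3 $ i * e1 $ j)
     + t * (e2 $ i * e3 $ j + e3 $ i * e2 $ j))"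

text \<open>The negative adjugate of \<open>conic_dual t\<close>. Unlike the inverse it exists at \<open>t = - 1\<close> too, where it is the square of
the linear form \<open>u1 + u3\<close>: the double line is a regular member of the family.\<close>

definition conic_mat :: "real \<Rightarrow> real^3^3" where
  "conic_mat t = (\<chi> i j. t * u1 $ i * (t * u1 $ j + (1 + t) * u2 $ j - u3 $ j)
     + (1 + t) * u2 $ i * (t * u1 $ j + (1 + t) * u2 $ j + u3 $ j)
     + u3 $ i * (- t * u1 $ j + (1 + t) * u2 $ j + u3 $ j))"

lemma conic_dual_apply:
  "conic_dual t *v u = (u \<bullet> e2 - (1 + t) * (u \<bullet> e3)) *\<^sub>R e1 + (u \<bullet> e1 + t * (u \<bullet> e3)) *\<^sub>R e2
     + (t * (u \<bullet> e2) - (1 + t) * (u \<bullet> e1)) *\<^sub>R e3"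
  by (simp add: conic_dual_def vec_eq_iff matrix_vector_mult_def inner_vec_def sum_3 algebra_simps)

lemma conic_mat_apply:
  "conic_mat t *v x = (t * (t * (u1 \<bullet> x) + (1 + t) * (u2 \<bullet> x) - (u3 \<bullet> x))) *\<^sub>R u1
     + ((1 + t) * (t * (u1 \<bullet> x) + (1 + t) * (u2 \<bullet> x) + (u3 \<bullet> x))) *\<^sub>R u2
     + (- t * (u1 \<bullet> x) + (1 + t) * (u2 \<bullet> x) + (u3 \<bullet> x)) *\<^sub>R u3"
  by (simp add: conic_mat_def vec_eq_iff matrix_vector_mult_def inner_vec_def sum_3 algebra_simps)

lemma conic_symmetric: "transpose (conic_mat t) = conic_mat t" "transpose (conic_dual t) = conic_dual t"
  by (simp_all add: conic_mat_def conic_dual_def transpose_def vec_eq_iff algebra_simps)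

lemma conic_mat_dual_apply: "conic_mat t *v (conic_dual t *v u) = (2 * t * (1 + t)) *\<^sub>R u"
proof -
  have "conic_mat t *v (conic_dual t *v u) =
      (2 * t * (1 + t)) *\<^sub>R ((u \<bullet> e1) *\<^sub>R u1 + (u \<bullet> e2) *\<^sub>R u2 + (u \<bullet> e3) *\<^sub>R u3)"
    unfolding conic_mat_apply conic_dual_apply scaleR_add_right scaleR_scaleR
    by (intro arg_cong2[of _ _ _ _ "(+)"] arg_cong2[of _ _ _ _ scaleR] refl)
       (simp_all add: inner_add_right algebra_simps)
  then show ?thesis
    unfolding expand_line[of u, symmetric] .
qed

lemma conic_dual_pair:
  assumes "t \<noteq> 0" "t \<noteq> - 1"
  shows "dual_pair (conic_mat t) ((1 / (2 * t * (1 + t))) *\<^sub>R conic_dual t)"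
proof -
  have "1 + t \<noteq> 0" using assms by auto
  have "conic_mat t ** ((1 / (2 * t * (1 + t))) *\<^sub>R conic_dual t) = mat 1" (is "_ ** ?N = _")
  proof (rule iffD2[OF matrix_eq], rule allI)
    fix u
    have "conic_mat t *v (?N *v u) = (1 / (2 * t * (1 + t))) *\<^sub>R (conic_mat t *v (conic_dual t *v u))"
      by (simp only: scaleR_matrix_vector_assoc[symmetric] matrix_vector_mult_scaleR)
    also have "\<dots> = u"
      using assms \<open>1 + t \<noteq> 0\<close> unfolding conic_mat_dual_apply by simp
    finally show "(conic_mat t ** ?N) *v u = mat 1 *v u"
      by (simp add: matrix_vector_mul_assoc)
  qed
  then show ?thesis
    by (simp add: dual_pair_def conic_symmetric transpose_scaleR_sym matrix_left_right_inverse)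
qed

lemma conic_double_line: "con (conic_mat (- 1)) = double_line (lin (u1 + u3))"
proof -
  have "conic_mat (- 1) = (\<chi> i j. (u1 + u3) $ i * (u1 + u3) $ j)"
    by (simp add: conic_mat_def vec_eq_iff algebra_simps)
  then show ?thesis
    using nonzero by (simp add: double_line_ln)
qed

text \<open>For the double line the point \<open>conic_dual (- 1) *v u\<close> lies on its support and on \<open>u\<close>, so one formula describes
the tangency points of all members.\<close>

lemma conic_tangency:
  assumes "t \<noteq> 0" and u: "u \<noteq> 0" "u \<bullet> (conic_dual t *v u) = 0" "u \<times> (u1 + u3) \<noteq> 0" "conic_dual t *v u \<noteq> 0"
  shows "tangency_point (con (conic_mat t)) (lin u) p \<longleftrightarrow> p = pt (conic_dual t *v u)"
proof (cases "t = - 1")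
  case True
  have "(u1 + u3) \<bullet> (conic_dual (- 1) *v u) = 0"
    by (simp add: conic_dual_apply inner_add_left inner_add_right inner_diff_right)
  then have "pt (conic_dual (- 1) *v u) lies_on lin u" "pt (conic_dual (- 1) *v u) lies_on lin (u1 + u3)"
    using u True nonzero by (simp_all add: lies_on_iff)
  moreover have "lin u \<noteq> lin (u1 + u3)"
    using u nonzero by (simp add: lin_eq_cross)
  ultimately show ?thesis
    unfolding True conic_double_line tangency_point_double_line
    by (metis lies_on_both_iff_meet)
next
  case False
  then have "1 + t \<noteq> 0" by auto
  note dual = conic_dual_pair[OF assms(1) False]
  show ?thesis
    unfolding tangency_point_nondegenerate[OF dual_pair_nondegenerate[OF dual]]
      tangent_at_iff_polar[OF dual u(1)] scaleR_matrix_vector_assoc[symmetric]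
    using u assms(1) \<open>1 + t \<noteq> 0\<close> by (simp add: pt_scale)
qed

lemma conic_tangency_points:
  assumes "t \<noteq> 0"
  shows "tangency_point (con (conic_mat t)) (lin u1) p \<longleftrightarrow> p = pt (e2 - (1 + t) *\<^sub>R e3)"
    "tangency_point (con (conic_mat t)) (lin u2) p \<longleftrightarrow> p = pt (e1 + t *\<^sub>R e3)"
    "tangency_point (con (conic_mat t)) (lin u3) p \<longleftrightarrow> p = pt (t *\<^sub>R e2 - (1 + t) *\<^sub>R e1)"
    "tangency_point (con (conic_mat t)) (lin u4) p \<longleftrightarrow> p = pt (t *\<^sub>R e1 - (1 + t) *\<^sub>R e2 + e3)"
proof -
  have a: "conic_dual t *v u1 = e2 - (1 + t) *\<^sub>R e3" "conic_dual t *v u2 = e1 + t *\<^sub>R e3"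
    "conic_dual t *v u3 = t *\<^sub>R e2 - (1 + t) *\<^sub>R e1"
    "conic_dual t *v u4 = - (t *\<^sub>R e1 - (1 + t) *\<^sub>R e2 + e3)"
    by (simp_all add: conic_dual_apply inner_add_left algebra_simps)
  have n: "e2 - (1 + t) *\<^sub>R e3 \<noteq> 0" "e1 + t *\<^sub>R e3 \<noteq> 0" "t *\<^sub>R e2 - (1 + t) *\<^sub>R e1 \<noteq> 0"
    "t *\<^sub>R e1 - (1 + t) *\<^sub>R e2 + e3 \<noteq> 0"
  proof -
    have "u2 \<bullet> (e2 - (1 + t) *\<^sub>R e3) = 1" "u1 \<bullet> (e1 + t *\<^sub>R e3) = 1" "u2 \<bullet> (t *\<^sub>R e2 - (1 + t) *\<^sub>R e1) = t"
      "u3 \<bullet> (t *\<^sub>R e1 - (1 + t) *\<^sub>R e2 + e3) = 1"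
      by (simp_all add: inner_diff_right inner_add_right)
    with assms show "e2 - (1 + t) *\<^sub>R e3 \<noteq> 0" "e1 + t *\<^sub>R e3 \<noteq> 0" "t *\<^sub>R e2 - (1 + t) *\<^sub>R e1 \<noteq> 0"
      "t *\<^sub>R e1 - (1 + t) *\<^sub>R e2 + e3 \<noteq> 0" by fastforce+
  qed
  have i: "u \<bullet> (conic_dual t *v u) = 0" if "u \<in> {u1, u2, u3, u4}" for u
    using that by (auto simp: a inner_diff_right inner_add_right inner_add_left)
  have c: "u \<times> (u1 + u3) \<noteq> 0" if "u \<in> {u1, u2, u3, u4}" for u
  proof
    assume 0: "u \<times> (u1 + u3) = 0"
    have "u \<noteq> 0" using that nonzero by auto
    then obtain r where "u1 + u3 = r *\<^sub>R u"
      using 0 by (rule cross_zero_multiple)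
    then have "(u1 + u3) \<bullet> x = r * (u \<bullet> x)" for x
      by simp
    from this[of e1] this[of e2] this[of e3] show False
      using that by (auto simp: inner_add_left)
  qed
  show "tangency_point (con (conic_mat t)) (lin u1) p \<longleftrightarrow> p = pt (e2 - (1 + t) *\<^sub>R e3)"
    "tangency_point (con (conic_mat t)) (lin u2) p \<longleftrightarrow> p = pt (e1 + t *\<^sub>R e3)"
    "tangency_point (con (conic_mat t)) (lin u3) p \<longleftrightarrow> p = pt (t *\<^sub>R e2 - (1 + t) *\<^sub>R e1)"
    using conic_tangency[OF assms _ i c, of u1] conic_tangency[OF assms _ i c, of u2]
      conic_tangency[OF assms _ i c, of u3] nonzero n by (simp_all add: a)
  have "pt (- (t *\<^sub>R e1 - (1 + t) *\<^sub>R e2 + e3)) = pt (t *\<^sub>R e1 - (1 + t) *\<^sub>R e2 + e3)"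
    using pt_scale[of "- 1", OF _ n(4)] by simp
  then show "tangency_point (con (conic_mat t)) (lin u4) p \<longleftrightarrow> p = pt (t *\<^sub>R e1 - (1 + t) *\<^sub>R e2 + e3)"
    using conic_tangency[OF assms _ i c, of u4] nonzero n(4) by (simp add: a(4) del: minus_add_distrib minus_diff_eq)
qed

lemma quadrilateral_vertices:
  "meet (lin u1) (lin u2) = pt e3" "meet (lin u3) (lin u2) = pt e1" "meet (lin u1) (lin u3) = pt e2"
  "meet (lin u1) (lin u4) = pt (e2 - e3)" "meet (lin u3) (lin u4) = pt (e1 - e2)" "meet (lin u2) (lin u4) = pt (e1 - e3)"
proof -
  have m: "meet (lin u) (lin v) = pt x" if uv: "u \<bullet> x = 0" "v \<bullet> x = 0" "u \<bullet> y = 0" "v \<bullet> y \<noteq> 0" "u \<noteq> 0" "x \<noteq> 0" for u v x y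
  proof -
    have "v \<noteq> 0" using that by auto
    have "lin u \<noteq> lin v"
    proof
      assume "lin u = lin v"
      then obtain r where "v = r *\<^sub>R u"
        using uv \<open>v \<noteq> 0\<close> by (auto simp: lin_eq_iff)
      with uv show False by simp
    qed
    then show ?thesis
      using lies_on_both_iff_meet[of "lin u" "lin v" "pt x"] that \<open>v \<noteq> 0\<close> by (simp add: lies_on_iff)
  qed
  have "u2 \<bullet> (e2 - e3) = 1" "u1 \<bullet> (e1 - e2) = 1" "u1 \<bullet> (e1 - e3) = 1"
    by (simp_all add: inner_diff_right)
  then have n: "e2 - e3 \<noteq> 0" "e1 - e2 \<noteq> 0" "e1 - e3 \<noteq> 0"
    by fastforce+
  show "meet (lin u1) (lin u2) = pt e3" using nonzero by (intro m[where y = e2]) auto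
  show "meet (lin u3) (lin u2) = pt e1" using nonzero by (intro m[where y = e2]) auto
  show "meet (lin u1) (lin u3) = pt e2" using nonzero by (intro m[where y = e3]) auto
  show "meet (lin u1) (lin u4) = pt (e2 - e3)" using nonzero n
    by (intro m[where y = e2]) (auto simp: inner_diff_right inner_add_left)
  show "meet (lin u3) (lin u4) = pt (e1 - e2)" using nonzero n
    by (intro m[where y = e2]) (auto simp: inner_diff_right inner_add_left)
  show "meet (lin u2) (lin u4) = pt (e1 - e3)" using nonzero n
    by (intro m[where y = e1]) (auto simp: inner_diff_right inner_add_left)
qed

text \<open>A non-degenerate inscribed conic has a dual form of the shape \<open>conic_dual\<close>; the parameters that are left
out would make it degenerate.\<close>

lemma inscribed_conic_iff:
  assumes generic: "generic (lin u1) (lin u2) (lin u3) (lin u4)"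
  shows "inscribed_conic Q (lin u1) (lin u2) (lin u3) (lin u4) \<longleftrightarrow> (\<exists>t. t \<noteq> 0 \<and> Q = con (conic_mat t))"
proof
  assume "\<exists>t. t \<noteq> 0 \<and> Q = con (conic_mat t)"
  then obtain t where t: "t \<noteq> 0" and Q: "Q = con (conic_mat t)" by blast
  show "inscribed_conic Q (lin u1) (lin u2) (lin u3) (lin u4)"
  proof (cases "t = - 1")
    case True
    have "pt e2 lies_on lin (u1 + u3)" "pt (e1 - e3) lies_on lin (u1 + u3)"
      using nonzero by (simp_all add: lies_on_iff inner_add_left inner_diff_right)
    then show ?thesis
      unfolding inscribed_conic_def Q True conic_double_line quadrilateral_vertices by blast
  next
    case False
    have nd: "nondegenerate Q"
      unfolding Q by (rule dual_pair_nondegenerate[OF conic_dual_pair[OF t False]])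
    show ?thesis
      by (rule generic_inscribed[OF generic nd])
        (use conic_tangency_points[OF t] nd in
          \<open>auto simp: tangent_def Q tangency_point_nondegenerate\<close>)
  qed
next
  assume "inscribed_conic Q (lin u1) (lin u2) (lin u3) (lin u4)"
  then consider h where "Q = double_line h" "meet (lin u1) (lin u3) lies_on h" "meet (lin u2) (lin u4) lies_on h"
    | "nondegenerate Q" "tangent Q (lin u1)" "tangent Q (lin u2)" "tangent Q (lin u3)" "tangent Q (lin u4)"
    by (auto simp: inscribed_conic_def tangent_def)
  then show "\<exists>t. t \<noteq> 0 \<and> Q = con (conic_mat t)"
  proof cases
    case 1
    obtain w where w: "w \<noteq> 0" "h = lin w" by (rule lin_cases)
    have z: "w \<bullet> e2 = 0" "w \<bullet> e1 = w \<bullet> e3"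
      using 1 w nonzero by (simp_all add: quadrilateral_vertices lies_on_iff inner_diff_right)
    have "w = (w \<bullet> e1) *\<^sub>R (u1 + u3)"
      by (rule trans[OF expand_line[of w]]) (simp add: z scaleR_add_right)
    moreover from this have "w \<bullet> e1 \<noteq> 0" using w by auto
    ultimately have "lin w = lin (u1 + u3)"
      using lin_scale[of "w \<bullet> e1" "u1 + u3"] nonzero by simp
    then show ?thesis
      using 1 w conic_double_line by (intro exI[of _ "- 1"]) simp
  next
    case 2
    obtain M N where MN: "dual_pair M N" and Q: "Q = con M"
      using 2(1) by (rule nondegenerate_cases)
    define a b c where "a = u2 \<bullet> (N *v u3)" and "b = u1 \<bullet> (N *v u3)" and "c = u1 \<bullet> (N *v u2)"
    note sym = dual_pair_form(2)[OF MN]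
    have i: "u1 \<bullet> (N *v u1) = 0" "u2 \<bullet> (N *v u2) = 0" "u3 \<bullet> (N *v u3) = 0" "u4 \<bullet> (N *v u4) = 0"
      using 2 nonzero by (simp_all add: Q tangent_iff[OF MN])
    have abc': "u2 \<bullet> (N *v u1) = c" "u3 \<bullet> (N *v u1) = b" "u3 \<bullet> (N *v u2) = a"
      using sym by (auto simp: a_def b_def c_def)
    note abc = i(1-3) abc' a_def[symmetric] b_def[symmetric] c_def[symmetric]
    have "u4 \<bullet> (N *v u4) = 2 * (a + b + c)"
      by (simp add: matrix_vector_right_distrib inner_add_left inner_add_right abc)
    with i(4) have sum: "a + b + c = 0" by simp
    have Nu: "N *v u1 = c *\<^sub>R e2 + b *\<^sub>R e3" "N *v u2 = c *\<^sub>R e1 + a *\<^sub>R e3" "N *v u3 = b *\<^sub>R e1 + a *\<^sub>R e2"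
      by (rule trans[OF expand_point], simp add: abc)+
    have N0: "N *v u \<noteq> 0" if "u \<noteq> 0" for u
      using that MN dual_pair_eq_0 dual_pair_sym by blast
    have "a \<noteq> 0"
    proof
      assume "a = 0"
      then have "N *v (b *\<^sub>R u2 - c *\<^sub>R u3) = 0"
        by (simp add: matrix_vector_mult_diff_distrib matrix_vector_mult_scaleR Nu)
      then have "b *\<^sub>R u2 - c *\<^sub>R u3 = 0" using N0 by blast
      then have "(b *\<^sub>R u2 - c *\<^sub>R u3) \<bullet> e2 = 0" "(b *\<^sub>R u2 - c *\<^sub>R u3) \<bullet> e3 = 0" by simp_all
      then have "N *v u1 = 0" by (simp add: Nu inner_diff_left)
      with N0 nonzero show False by blast
    qed
    have "c \<noteq> 0"
    proof
      assume "c = 0"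
      then have "N *v (a *\<^sub>R u1 - b *\<^sub>R u2) = 0"
        by (simp add: matrix_vector_mult_diff_distrib matrix_vector_mult_scaleR Nu)
      then have "a *\<^sub>R u1 - b *\<^sub>R u2 = 0" using N0 by blast
      then have "(a *\<^sub>R u1 - b *\<^sub>R u2) \<bullet> e1 = 0" by simp
      with \<open>a \<noteq> 0\<close> show False by (simp add: inner_diff_left)
    qed
    define t where "t = a / c"
    have t: "t \<noteq> 0" "a = c * t" "b = - c * (1 + t)"
      using \<open>a \<noteq> 0\<close> \<open>c \<noteq> 0\<close> sum by (simp_all add: t_def algebra_simps)
    have N: "N *v u = c *\<^sub>R (conic_dual t *v u)" for u
    proof -
      have "N *v u = (u \<bullet> e1) *\<^sub>R (N *v u1) + (u \<bullet> e2) *\<^sub>R (N *v u2) + (u \<bullet> e3) *\<^sub>R (N *v u3)"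
        using arg_cong[OF expand_line[of u], of "\<lambda>x. N *v x"]
        by (simp only: matrix_vector_right_distrib matrix_vector_mult_scaleR)
      then show ?thesis
        unfolding Nu conic_dual_apply t(2,3) by (simp add: algebra_simps)
    qed
    define r where "r = 2 * t * (1 + t) * c"
    have "conic_mat t *v x = r *\<^sub>R (M *v x)" for x
    proof -
      have "conic_mat t *v x = conic_mat t *v (N *v (M *v x))"
        using dual_pair_cancel(2)[OF MN] by simp
      also have "\<dots> = r *\<^sub>R (M *v x)"
        by (simp add: N matrix_vector_mult_scaleR conic_mat_dual_apply r_def)
      finally show ?thesis .
    qed
    then have C: "conic_mat t = r *\<^sub>R M"
      by (simp add: matrix_eq scaleR_matrix_vector_assoc[symmetric])
    have "r \<noteq> 0"
    proof
      assume "r = 0"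
      then have "b = 0" using t \<open>c \<noteq> 0\<close> by (auto simp: r_def)
      then have "N *v (a *\<^sub>R u1 - c *\<^sub>R u3) = 0"
        by (simp add: matrix_vector_mult_diff_distrib matrix_vector_mult_scaleR Nu)
      then have "a *\<^sub>R u1 - c *\<^sub>R u3 = 0" using N0 by blast
      then have "(a *\<^sub>R u1 - c *\<^sub>R u3) \<bullet> e1 = 0" by simp
      with \<open>a \<noteq> 0\<close> show False by (simp add: inner_diff_left)
    qed
    then have "Q = con (conic_mat t)"
      using con_scale dual_pair_nonzero[OF MN] by (simp add: Q C)
    with t show ?thesis by blast
  qed
qed

end

lemma dual_bases_exist:
  assumes "u1 \<bullet> (u2 \<times> u3) \<noteq> 0"
  obtains e1 e2 e3 where "dual_bases u1 u2 u3 e1 e2 e3"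
proof -
  define d where "d = u1 \<bullet> (u2 \<times> u3)"
  have d: "d \<noteq> 0" "u2 \<bullet> (u3 \<times> u1) = d" "u3 \<bullet> (u1 \<times> u2) = d"
    using assms by (simp_all add: d_def cross3_def inner_vec_def sum_3 algebra_simps)
  have e: "d *\<^sub>R x = (u1 \<bullet> x) *\<^sub>R (u2 \<times> u3) + (u2 \<bullet> x) *\<^sub>R (u3 \<times> u1) + (u3 \<bullet> x) *\<^sub>R (u1 \<times> u2)" for x
    by (simp add: d_def cross3_def inner_vec_def sum_3 vec_eq_iff forall_3 algebra_simps)
  \<comment> \<open>Cramer's rule.\<close>
  have "x = (1 / d) *\<^sub>R (d *\<^sub>R x)" for x :: "real^3"
    using d by simp
  then have "dual_bases u1 u2 u3 ((1 / d) *\<^sub>R (u2 \<times> u3)) ((1 / d) *\<^sub>R (u3 \<times> u1)) ((1 / d) *\<^sub>R (u1 \<times> u2))"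
    using d d_def unfolding e by unfold_locales (simp_all add: dot_cross_self scaleR_add_right)
  with that show ?thesis .
qed

text \<open>Since no three of the lines are concurrent, the fourth is a combination of the others with
non-zero coefficients, which can be absorbed into the representatives.\<close>

lemma generic_normal_form:
  assumes "generic k l k' l'"
  obtains u1 u2 u3 e1 e2 e3 where "dual_bases u1 u2 u3 e1 e2 e3"
    "k = lin u1" "l = lin u2" "k' = lin u3" "l' = lin (u1 + u2 + u3)"
proof -
  obtain v1 where v1: "v1 \<noteq> 0" "k = lin v1" by (rule lin_cases)
  obtain v2 where v2: "v2 \<noteq> 0" "l = lin v2" by (rule lin_cases)
  obtain v3 where v3: "v3 \<noteq> 0" "k' = lin v3" by (rule lin_cases)
  obtain v4 where v4: "v4 \<noteq> 0" "l' = lin v4" by (rule lin_cases)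
  have nc: "\<not> (\<exists>p. p lies_on k \<and> p lies_on l \<and> p lies_on k')" "\<not> (\<exists>p. p lies_on k \<and> p lies_on l \<and> p lies_on l')"
    "\<not> (\<exists>p. p lies_on k \<and> p lies_on k' \<and> p lies_on l')" "\<not> (\<exists>p. p lies_on l \<and> p lies_on k' \<and> p lies_on l')"
    and "k \<noteq> l"
    using assms by (auto simp: generic_def)
  have c: "v1 \<times> v2 \<noteq> 0"
    using \<open>k \<noteq> l\<close> v1 v2 by (simp add: lin_eq_cross)
  have "v1 \<bullet> (v2 \<times> v3) \<noteq> 0"
  proof
    assume "v1 \<bullet> (v2 \<times> v3) = 0"
    then have "v3 \<bullet> (v1 \<times> v2) = 0"
      by (simp add: cross3_def inner_vec_def sum_3 algebra_simps)
    then have "pt (v1 \<times> v2) lies_on k \<and> pt (v1 \<times> v2) lies_on l \<and> pt (v1 \<times> v2) lies_on k'"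
      using v1 v2 v3 c by (simp add: lies_on_iff dot_cross_self)
    with nc show False by blast
  qed
  then obtain f1 f2 f3 where "dual_bases v1 v2 v3 f1 f2 f3"
    by (rule dual_bases_exist)
  then interpret dual_bases v1 v2 v3 f1 f2 f3 .
  define a1 a2 a3 where "a1 = v4 \<bullet> f1" and "a2 = v4 \<bullet> f2" and "a3 = v4 \<bullet> f3"
  have "a1 \<noteq> 0"
    using nc(4) v2 v3 v4 nonzero by (auto simp: a1_def lies_on_iff dest: spec[of _ "pt f1"])
  have "a2 \<noteq> 0"
    using nc(3) v1 v3 v4 nonzero by (auto simp: a2_def lies_on_iff dest: spec[of _ "pt f2"])
  have "a3 \<noteq> 0"
    using nc(2) v1 v2 v4 nonzero by (auto simp: a3_def lies_on_iff dest: spec[of _ "pt f3"])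
  show ?thesis
  proof (rule that)
    show "dual_bases (a1 *\<^sub>R v1) (a2 *\<^sub>R v2) (a3 *\<^sub>R v3) ((1 / a1) *\<^sub>R f1) ((1 / a2) *\<^sub>R f2) ((1 / a3) *\<^sub>R f3)"
      using \<open>a1 \<noteq> 0\<close> \<open>a2 \<noteq> 0\<close> \<open>a3 \<noteq> 0\<close> expand_point by unfold_locales auto
    show "k = lin (a1 *\<^sub>R v1)" "l = lin (a2 *\<^sub>R v2)" "k' = lin (a3 *\<^sub>R v3)"
      using \<open>a1 \<noteq> 0\<close> \<open>a2 \<noteq> 0\<close> \<open>a3 \<noteq> 0\<close> v1 v2 v3 by (simp_all add: lin_scale)
    show "l' = lin (a1 *\<^sub>R v1 + a2 *\<^sub>R v2 + a3 *\<^sub>R v3)"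
      unfolding a1_def a2_def a3_def expand_line[of v4, symmetric] by (rule v4(2))
  qed
qed

lemma cross_nonzeroI:
  fixes v w a :: "real^3"
  assumes "a \<bullet> v \<noteq> 0" "a \<bullet> w = 0" "w \<noteq> 0"
  shows "v \<times> w \<noteq> 0"
proof
  assume "v \<times> w = 0"
  then have "w \<times> v = 0" using cross_skew[of w v] by simp
  then obtain c where "v = c *\<^sub>R w" using assms(3) cross_zero_multiple by blast
  with assms show False by simp
qed

lemma point_eq_iff_frame_coord:
  assumes "v \<times> w \<noteq> 0" "V = pt v" "W = pt w" "T = pt (v + w)" "q = v + s *\<^sub>R w"
  shows "p = pt q \<longleftrightarrow> frame_coord V W T s p"
  using frame_coord_iff[OF assms(1)] assms by simp

text \<open>If \<open>D\<close> is the member \<open>t\<close> of the family, let \<open>P s\<close> be the member \<open>s * t\<close>. The tangency points are linear in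
the parameter; at its excluded values \<open>0\<close> and \<open>\<infinity>\<close> they move to the endpoints of the edges, namely to
\<open>k \<inter> l'\<close>, \<open>k' \<inter> l\<close> and to \<open>k \<inter> l\<close>, \<open>k' \<inter> l'\<close>. An edge that plays the role of \<open>k'\<close> here is
the edge \<open>k\<close> of the neighbouring quadrilateral, and there the endpoints are exchanged; likewise for \<open>l'\<close>
and \<open>l\<close>.\<close>

lemma touching_parameter:
  assumes generic: "generic k l k' l'" and nd: "nondegenerate D"
    and tangent: "tangent_at D k Tk" "tangent_at D l Tl" "tangent_at D k' Tk'" "tangent_at D l' Tl'"
  obtains P where "\<And>Q. inscribed_conic Q k l k' l' \<longleftrightarrow> (\<exists>s. s \<noteq> 0 \<and> Q = P s)"
    and "\<And>s p. s \<noteq> 0 \<Longrightarrow> tangency_point (P s) k p \<longleftrightarrow> frame_coord (meet k l') (meet k l) Tk s p"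
    and "\<And>s p. s \<noteq> 0 \<Longrightarrow> tangency_point (P s) l p \<longleftrightarrow> frame_coord (meet k' l) (meet k l) Tl s p"
    and "\<And>s p. s \<noteq> 0 \<Longrightarrow> tangency_point (P s) k' p \<longleftrightarrow> frame_coord (meet k' l) (meet k' l') Tk' s p"
    and "\<And>s p. s \<noteq> 0 \<Longrightarrow> tangency_point (P s) l' p \<longleftrightarrow> frame_coord (meet k l') (meet k' l') Tl' s p"
proof -
  obtain u1 u2 u3 e1 e2 e3 where "dual_bases u1 u2 u3 e1 e2 e3"
    and k: "k = lin u1" "l = lin u2" "k' = lin u3" "l' = lin (u1 + u2 + u3)"
    using generic_normal_form[OF generic] by metis
  then interpret dual_bases u1 u2 u3 e1 e2 e3 by simp
  have inscribed: "inscribed_conic Q k l k' l' \<longleftrightarrow> (\<exists>t. t \<noteq> 0 \<and> Q = con (conic_mat t))" for Q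
    using inscribed_conic_iff generic unfolding k by blast
  have "inscribed_conic D k l k' l'"
    using generic nd tangent by (intro generic_inscribed) (auto simp: tangent_def)
  then obtain t where t: "t \<noteq> 0" and D: "D = con (conic_mat t)"
    using inscribed by blast
  have "tangency_point D k Tk" "tangency_point D l Tl" "tangency_point D k' Tk'" "tangency_point D l' Tl'"
    using nd tangent by (simp_all add: tangency_point_nondegenerate)
  then have T: "Tk = pt (e2 - (1 + t) *\<^sub>R e3)" "Tl = pt (e1 + t *\<^sub>R e3)"
    "Tk' = pt (t *\<^sub>R e2 - (1 + t) *\<^sub>R e1)" "Tl' = pt (t *\<^sub>R e1 - (1 + t) *\<^sub>R e2 + e3)"
    unfolding D k conic_tangency_points[OF t] by simp_all
  have n: "e1 - e2 \<noteq> 0" "e2 - e3 \<noteq> 0"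
  proof -
    have "u1 \<bullet> (e1 - e2) = 1" "u2 \<bullet> (e2 - e3) = 1" by (simp_all add: inner_diff_right)
    then show "e1 - e2 \<noteq> 0" "e2 - e3 \<noteq> 0" by fastforce+
  qed
  have neg: "e2 - e1 = (- 1) *\<^sub>R (e1 - e2)" "e3 - e2 = (- 1) *\<^sub>R (e2 - e3)" by simp_all
  show ?thesis
  proof (rule that[of "\<lambda>s. con (conic_mat (s * t))"])
    show "inscribed_conic Q k l k' l' \<longleftrightarrow> (\<exists>s. s \<noteq> 0 \<and> Q = con (conic_mat (s * t)))" for Q
    proof
      assume "inscribed_conic Q k l k' l'"
      then obtain r where "r \<noteq> 0" "Q = con (conic_mat r)" using inscribed by blast
      then show "\<exists>s. s \<noteq> 0 \<and> Q = con (conic_mat (s * t))"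
        using t by (intro exI[of _ "r / t"]) simp
    next
      assume "\<exists>s. s \<noteq> 0 \<and> Q = con (conic_mat (s * t))"
      then obtain s where "s * t \<noteq> 0" "Q = con (conic_mat (s * t))" using t by auto
      then show "inscribed_conic Q k l k' l'" using inscribed by blast
    qed
  next
    fix s p
    assume "s \<noteq> (0::real)"
    then have st: "s * t \<noteq> 0" using t by simp
    note tp = conic_tangency_points[OF st]
    show "tangency_point (con (conic_mat (s * t))) k p \<longleftrightarrow> frame_coord (meet k l') (meet k l) Tk s p"
      unfolding k T tp(1) quadrilateral_vertices
    proof (rule point_eq_iff_frame_coord)
      show "(e2 - e3) \<times> (- t *\<^sub>R e3) \<noteq> 0"
        using t nonzero by (intro cross_nonzeroI[of u2]) (auto simp: inner_diff_right)
      show "pt e3 = pt (- t *\<^sub>R e3)"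
        using t nonzero by (simp only: pt_scale neg_equal_0_iff_equal not_False_eq_True)
    qed (simp_all add: algebra_simps)
    show "tangency_point (con (conic_mat (s * t))) l p \<longleftrightarrow> frame_coord (meet k' l) (meet k l) Tl s p"
      unfolding k T tp(2) quadrilateral_vertices
    proof (rule point_eq_iff_frame_coord)
      show "e1 \<times> (t *\<^sub>R e3) \<noteq> 0"
        using t nonzero by (intro cross_nonzeroI[of u1]) auto
      show "pt e3 = pt (t *\<^sub>R e3)"
        using t nonzero by (simp add: pt_scale)
    qed (simp_all add: algebra_simps)
    show "tangency_point (con (conic_mat (s * t))) k' p \<longleftrightarrow> frame_coord (meet k' l) (meet k' l') Tk' s p"
      unfolding k T tp(3) quadrilateral_vertices
    proof (rule point_eq_iff_frame_coord)
      show "((- 1) *\<^sub>R e1) \<times> (- t *\<^sub>R (e1 - e2)) \<noteq> 0"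
        using t n by (intro cross_nonzeroI[of "u1 + u2"]) (auto simp: inner_diff_right inner_add_left)
      show "pt (e1 - e2) = pt (- t *\<^sub>R (e1 - e2))"
        using t n by (simp only: pt_scale neg_equal_0_iff_equal not_False_eq_True)
      show "pt e1 = pt ((- 1) *\<^sub>R e1)"
        by (rule pt_scale[symmetric]) (use nonzero in simp_all)
    qed (simp_all add: algebra_simps)
    show "tangency_point (con (conic_mat (s * t))) l' p \<longleftrightarrow> frame_coord (meet k l') (meet k' l') Tl' s p"
      unfolding k T tp(4) quadrilateral_vertices
    proof (rule point_eq_iff_frame_coord)
      show "((- 1) *\<^sub>R (e2 - e3)) \<times> (t *\<^sub>R (e1 - e2)) \<noteq> 0"
        using t n by (intro cross_nonzeroI[of u3]) (auto simp: inner_diff_right)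
      show "pt (e1 - e2) = pt (t *\<^sub>R (e1 - e2))"
        using t n by (simp only: pt_scale not_False_eq_True)
      show "pt (e2 - e3) = pt ((- 1) *\<^sub>R (e2 - e3))"
        by (rule pt_scale[symmetric]) (use n in simp_all)
    qed (simp_all add: algebra_simps)
  qed
qed

lemma inscribed_conic_touches:
  assumes "generic k l k' l'" "inscribed_conic Q k l k' l'" "e \<in> {k, l, k', l'}"
  shows "\<exists>p. tangency_point Q e p"
proof -
  obtain u1 u2 u3 e1 e2 e3 where "dual_bases u1 u2 u3 e1 e2 e3"
    and k: "k = lin u1" "l = lin u2" "k' = lin u3" "l' = lin (u1 + u2 + u3)"
    using generic_normal_form[OF assms(1)] by metis
  then interpret dual_bases u1 u2 u3 e1 e2 e3 by simp
  obtain t where t: "t \<noteq> 0" "Q = con (conic_mat t)"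
    using inscribed_conic_iff assms unfolding k by blast
  from assms(3) show ?thesis
    unfolding k t(2) using conic_tangency_points[OF t(1)] by auto
qed

unbundle no cross3_syntax

section \<open>Grids of tangents of a conic\<close>

text \<open>The parameters of an instance: \<open>t\<close> and its inverse on the two colours of a chessboard.\<close>

definition alternate :: "real \<Rightarrow> nat \<Rightarrow> nat \<Rightarrow> real" where
  "alternate t i j = (if even (i + j) then t else inverse t)"

lemma alternate_simps:
  "alternate t (Suc i) j = inverse (alternate t i j)" "alternate t i (Suc j) = inverse (alternate t i j)"
  "alternate (alternate t i j) i j = t" "alternate t i j = 0 \<longleftrightarrow> t = 0"
  by (auto simp: alternate_def)

text \<open>The frames of \<open>touching_parameter\<close> on a common edge of two neighbouring quadrilaterals differ only by the
exchange of \<open>0\<close> and \<open>\<infinity>\<close>, because \<open>1\<close> is the tangency point of the same conic \<open>D\<close>. So touching means that the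
parameters are inverse, and an instance is determined by its parameter in any one quadrilateral.\<close>

theorem tangent_grid_admits_touching_family:
  assumes nd: "nondegenerate D"
    and generic: "\<And>i j. i \<in> {1..m} \<Longrightarrow> j \<in> {1..n} \<Longrightarrow> generic (k (i - 1)) (l (j - 1)) (k i) (l j)"
    and tangent: "\<And>i. i \<le> m \<Longrightarrow> tangent D (k i)" "\<And>j. j \<le> n \<Longrightarrow> tangent D (l j)"
  shows "admits_touching_family m n k l"
proof -
  obtain Tk where Tk: "\<And>i. i \<le> m \<Longrightarrow> tangent_at D (k i) (Tk i)"
    using tangent(1) unfolding tangent_def by metis
  obtain Tl where Tl: "\<And>j. j \<le> n \<Longrightarrow> tangent_at D (l j) (Tl j)"
    using tangent(2) unfolding tangent_def by metis
  define good where "good i j P \<longleftrightarrow>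
    (\<forall>Q. inscribed_conic Q (k (i - 1)) (l (j - 1)) (k i) (l j) \<longleftrightarrow> (\<exists>s. s \<noteq> 0 \<and> Q = P s)) \<and>
    (\<forall>s p. s \<noteq> 0 \<longrightarrow>
      (tangency_point (P s) (k (i - 1)) p \<longleftrightarrow>
        frame_coord (meet (k (i - 1)) (l j)) (meet (k (i - 1)) (l (j - 1))) (Tk (i - 1)) s p) \<and>
      (tangency_point (P s) (l (j - 1)) p \<longleftrightarrow>
        frame_coord (meet (k i) (l (j - 1))) (meet (k (i - 1)) (l (j - 1))) (Tl (j - 1)) s p) \<and>
      (tangency_point (P s) (k i) p \<longleftrightarrow>
        frame_coord (meet (k i) (l (j - 1))) (meet (k i) (l j)) (Tk i) s p) \<and>
      (tangency_point (P s) (l j) p \<longleftrightarrow>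
        frame_coord (meet (k (i - 1)) (l j)) (meet (k i) (l j)) (Tl j) s p))" for i j P
  have "\<exists>P. good i j P" if "i \<in> {1..m}" "j \<in> {1..n}" for i j
  proof -
    have "tangent_at D (k (i - 1)) (Tk (i - 1))" "tangent_at D (l (j - 1)) (Tl (j - 1))"
      "tangent_at D (k i) (Tk i)" "tangent_at D (l j) (Tl j)"
      using that Tk Tl by auto
    from touching_parameter[OF generic[OF that] nd this]
    obtain P where "\<And>Q. inscribed_conic Q (k (i - 1)) (l (j - 1)) (k i) (l j) \<longleftrightarrow> (\<exists>s. s \<noteq> 0 \<and> Q = P s)"
      and "\<And>s p. s \<noteq> 0 \<Longrightarrow> tangency_point (P s) (k (i - 1)) p \<longleftrightarrow>
        frame_coord (meet (k (i - 1)) (l j)) (meet (k (i - 1)) (l (j - 1))) (Tk (i - 1)) s p"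
      and "\<And>s p. s \<noteq> 0 \<Longrightarrow> tangency_point (P s) (l (j - 1)) p \<longleftrightarrow>
        frame_coord (meet (k i) (l (j - 1))) (meet (k (i - 1)) (l (j - 1))) (Tl (j - 1)) s p"
      and "\<And>s p. s \<noteq> 0 \<Longrightarrow> tangency_point (P s) (k i) p \<longleftrightarrow>
        frame_coord (meet (k i) (l (j - 1))) (meet (k i) (l j)) (Tk i) s p"
      and "\<And>s p. s \<noteq> 0 \<Longrightarrow> tangency_point (P s) (l j) p \<longleftrightarrow>
        frame_coord (meet (k (i - 1)) (l j)) (meet (k i) (l j)) (Tl j) s p"
      by blast
    then have "good i j P"
      by (simp add: good_def)
    then show ?thesis by (rule exI[where P = "good i j"])
  qed
  then obtain P where P: "\<And>i j. i \<in> {1..m} \<Longrightarrow> j \<in> {1..n} \<Longrightarrow> good i j (P i j)"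
    by metis
  have inscribed: "inscribed_conic Q (k (i - 1)) (l (j - 1)) (k i) (l j) \<longleftrightarrow> (\<exists>s. s \<noteq> 0 \<and> Q = P i j s)"
    if "i \<in> {1..m}" "j \<in> {1..n}" for i j Q
    using P[OF that] by (simp add: good_def)
  have tp: "tangency_point (P i j s) (k (i - 1)) p \<longleftrightarrow>
        frame_coord (meet (k (i - 1)) (l j)) (meet (k (i - 1)) (l (j - 1))) (Tk (i - 1)) s p"
      "tangency_point (P i j s) (l (j - 1)) p \<longleftrightarrow>
        frame_coord (meet (k i) (l (j - 1))) (meet (k (i - 1)) (l (j - 1))) (Tl (j - 1)) s p"
      "tangency_point (P i j s) (k i) p \<longleftrightarrow>
        frame_coord (meet (k i) (l (j - 1))) (meet (k i) (l j)) (Tk i) s p"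
      "tangency_point (P i j s) (l j) p \<longleftrightarrow>
        frame_coord (meet (k (i - 1)) (l j)) (meet (k i) (l j)) (Tl j) s p"
    if "i \<in> {1..m}" "j \<in> {1..n}" "s \<noteq> 0" for i j s p
    using P[OF that(1,2)] that(3) by (auto simp: good_def)
  have touch: "\<exists>p. tangency_point (P i j s) e p"
    if "i \<in> {1..m}" "j \<in> {1..n}" "s \<noteq> 0" "e \<in> {k (i - 1), l (j - 1), k i, l j}" for i j s e
    using inscribed_conic_touches[OF generic[OF that(1,2)] _ that(4)] inscribed[OF that(1,2)] that(3) by blast
  have touch_k: "(\<exists>p. tangency_point (P i j s) (k i) p \<and> tangency_point (P (Suc i) j t) (k i) p) \<longleftrightarrow> t = inverse s"
    if "i \<in> {1..<m}" "j \<in> {1..n}" "s \<noteq> 0" "t \<noteq> 0" for i j s t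
  proof -
    have 1: "tangency_point (P i j s) (k i) p \<longleftrightarrow>
        frame_coord (meet (k i) (l j)) (meet (k i) (l (j - 1))) (Tk i) (inverse s) p" for p
      using tp(3)[of i j s p] that by (simp add: frame_coord_swap_iff)
    have 2: "tangency_point (P (Suc i) j t) (k i) p \<longleftrightarrow>
        frame_coord (meet (k i) (l j)) (meet (k i) (l (j - 1))) (Tk i) t p" for p
      using tp(1)[of "Suc i" j t p] that by simp
    show ?thesis
      using touch[of i j s "k i"] that unfolding 1 2 by (auto dest: frame_coord_unique)
  qed
  have touch_l: "(\<exists>p. tangency_point (P i j s) (l j) p \<and> tangency_point (P i (Suc j) t) (l j) p) \<longleftrightarrow> t = inverse s"
    if "i \<in> {1..m}" "j \<in> {1..<n}" "s \<noteq> 0" "t \<noteq> 0" for i j s t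
  proof -
    have 1: "tangency_point (P i j s) (l j) p \<longleftrightarrow>
        frame_coord (meet (k i) (l j)) (meet (k (i - 1)) (l j)) (Tl j) (inverse s) p" for p
      using tp(4)[of i j s p] that by (simp add: frame_coord_swap_iff)
    have 2: "tangency_point (P i (Suc j) t) (l j) p \<longleftrightarrow>
        frame_coord (meet (k i) (l j)) (meet (k (i - 1)) (l j)) (Tl j) t p" for p
      using tp(2)[of i "Suc j" t p] that by simp
    show ?thesis
      using touch[of i j s "l j"] that unfolding 1 2 by (auto dest: frame_coord_unique)
  qed
  define inst where "inst t = (\<lambda>(i, j)\<in>{1..m} \<times> {1..n}. P i j (alternate t i j))" for t
  have inst_at: "inst t (i, j) = P i j (alternate t i j)" if "i \<in> {1..m}" "j \<in> {1..n}" for t i j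
    using that by (simp add: inst_def)
  have instances: "Q \<in> touching_instances m n k l \<longleftrightarrow> (\<exists>t. t \<noteq> 0 \<and> Q = inst t)" for Q
  proof
    assume "\<exists>t. t \<noteq> 0 \<and> Q = inst t"
    then obtain t where t: "t \<noteq> 0" "Q = inst t" by blast
    have "inscribed_conic (Q (i, j)) (k (i - 1)) (l (j - 1)) (k i) (l j)" if "i \<in> {1..m}" "j \<in> {1..n}" for i j
      unfolding inscribed[OF that] t(2) inst_at[OF that] using t(1) alternate_simps(4) by blast
    moreover have "\<exists>p. tangency_point (Q (i, j)) (k i) p \<and> tangency_point (Q (i + 1, j)) (k i) p"
      if "i \<in> {1..<m}" "j \<in> {1..n}" for i j
      using that t(1) touch_k[OF that, of "alternate t i j" "alternate t (Suc i) j"]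
      by (simp add: t(2) inst_at alternate_simps)
    moreover have "\<exists>p. tangency_point (Q (i, j)) (l j) p \<and> tangency_point (Q (i, j + 1)) (l j) p"
      if "i \<in> {1..m}" "j \<in> {1..<n}" for i j
      using that t(1) touch_l[OF that, of "alternate t i j" "alternate t i (Suc j)"]
      by (simp add: t(2) inst_at alternate_simps)
    moreover have "Q \<in> extensional ({1..m} \<times> {1..n})"
      by (simp add: t(2) inst_def)
    ultimately show "Q \<in> touching_instances m n k l"
      by (simp add: touching_instances_def)
  next
    assume "Q \<in> touching_instances m n k l"
    then have Q: "Q \<in> extensional ({1..m} \<times> {1..n})"
      and ins: "\<And>i j. i \<in> {1..m} \<Longrightarrow> j \<in> {1..n} \<Longrightarrow> inscribed_conic (Q (i, j)) (k (i - 1)) (l (j - 1)) (k i) (l j)"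
      and tk: "\<And>i j. i \<in> {1..<m} \<Longrightarrow> j \<in> {1..n} \<Longrightarrow>
        \<exists>p. tangency_point (Q (i, j)) (k i) p \<and> tangency_point (Q (Suc i, j)) (k i) p"
      and tl: "\<And>i j. i \<in> {1..m} \<Longrightarrow> j \<in> {1..<n} \<Longrightarrow>
        \<exists>p. tangency_point (Q (i, j)) (l j) p \<and> tangency_point (Q (i, Suc j)) (l j) p"
      by (simp_all add: touching_instances_def)
    have "\<forall>i j. \<exists>s. s \<noteq> 0 \<and> (i \<in> {1..m} \<longrightarrow> j \<in> {1..n} \<longrightarrow> Q (i, j) = P i j s)"
      using ins inscribed by (metis zero_neq_one)
    then obtain S where S0: "\<And>i j. S i j \<noteq> 0"
      and S: "\<And>i j. i \<in> {1..m} \<Longrightarrow> j \<in> {1..n} \<Longrightarrow> Q (i, j) = P i j (S i j)"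
      by metis
    have Sk: "S (Suc i) j = inverse (S i j)" if "i \<in> {1..<m}" "j \<in> {1..n}" for i j
      using touch_k[OF that S0 S0] tk[OF that] that by (simp add: S)
    have Sl: "S i (Suc j) = inverse (S i j)" if "i \<in> {1..m}" "j \<in> {1..<n}" for i j
      using touch_l[OF that S0 S0] tl[OF that] that by (simp add: S)
    define t where "t = S 1 1"
    have row: "i \<le> m \<Longrightarrow> S i 1 = alternate t i 1" if "1 \<le> i" "1 \<le> n" for i
      using that(1)
    proof (induction i rule: dec_induct)
      case base
      then show ?case by (simp add: t_def alternate_def)
    next
      case (step i)
      then show ?case using Sk[of i 1] that(2) by (simp add: alternate_simps)
    qed
    have all: "j \<le> n \<Longrightarrow> S i j = alternate t i j" if "1 \<le> j" "i \<in> {1..m}" for i j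
      using that(1)
    proof (induction j rule: dec_induct)
      case base
      then show ?case using row[of i] that(2) by simp
    next
      case (step j)
      then show ?case using Sl[of i j] that(2) by (simp add: alternate_simps)
    qed
    have "Q = inst t"
    proof (rule extensionalityI[OF Q])
      show "inst t \<in> extensional ({1..m} \<times> {1..n})" by (simp add: inst_def)
      show "Q x = inst t x" if "x \<in> {1..m} \<times> {1..n}" for x
        using that by (cases x) (simp add: inst_at S all)
    qed
    then show "\<exists>t. t \<noteq> 0 \<and> Q = inst t"
      using S0 t_def by blast
  qed
  have unique: "\<exists>!Q. Q \<in> touching_instances m n k l \<and> tangency_point (Q (i, j)) e p"
    if ij: "i \<in> {1..m}" "j \<in> {1..n}"
      and e: "\<And>s p. s \<noteq> 0 \<Longrightarrow> tangency_point (P i j s) e p \<longleftrightarrow> frame_coord V W T s p"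
      and e': "e \<in> {k (i - 1), l (j - 1), k i, l j}"
      and p: "V lies_on e" "W lies_on e" "p lies_on e" "p \<noteq> V" "p \<noteq> W" for i j e V W T p
  proof -
    obtain q where q: "frame_coord V W T 1 q"
      using touch[OF ij _ e', of 1] e[of 1] by auto
    obtain s where s: "s \<noteq> 0" "frame_coord V W T s p"
      using frame_coord_exists[OF q p] .
    show ?thesis
    proof (rule ex1I[of _ "inst (alternate s i j)"])
      show "inst (alternate s i j) \<in> touching_instances m n k l \<and> tangency_point (inst (alternate s i j) (i, j)) e p"
      proof
        have "alternate s i j \<noteq> 0"
          using s(1) by (simp add: alternate_simps)
        then show "inst (alternate s i j) \<in> touching_instances m n k l"
          unfolding instances by blast
        show "tangency_point (inst (alternate s i j) (i, j)) e p"
          unfolding inst_at[OF ij] alternate_simps(3) e[OF s(1)] by (rule s(2))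
      qed
    next
      fix Q
      assume Q: "Q \<in> touching_instances m n k l \<and> tangency_point (Q (i, j)) e p"
      then have "\<exists>t. t \<noteq> 0 \<and> Q = inst t"
        unfolding instances ..
      then obtain t where t: "t \<noteq> 0" "Q = inst t"
        by blast
      have "tangency_point (inst t (i, j)) e p"
        using Q t(2) by simp
      with t(1) have "frame_coord V W T (alternate t i j) p"
        using e[of "alternate t i j"] ij by (simp add: inst_at alternate_simps)
      with s have "alternate t i j = s"
        using frame_coord_unique by blast
      then have "alternate s i j = t"
        using alternate_simps(3)[of t i j] by simp
      with t(2) show "Q = inst (alternate s i j)" by simp
    qed
  qed
  show ?thesis
    unfolding admits_touching_family_def
  proof (intro ballI conjI allI impI)
    fix i j e p
    assume ij: "i \<in> {1..m}" "j \<in> {1..n}" and e: "e \<in> {k (i - 1), k i}"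
      and p: "p lies_on e \<and> p \<noteq> meet e (l (j - 1)) \<and> p \<noteq> meet e (l j)"
    have d: "distinct [k (i - 1), l (j - 1), k i, l j]"
      using generic[OF ij] by (simp add: generic_def)
    show "\<exists>!Q. Q \<in> touching_instances m n k l \<and> tangency_point (Q (i, j)) e p"
    proof (cases "e = k i")
      case True
      show ?thesis
        using p d meet_lies_on unfolding True
        by (intro unique[OF ij tp(3)[OF ij]]) auto
    next
      case False
      then have e: "e = k (i - 1)" using e by simp
      show ?thesis
        using p d meet_lies_on unfolding e
        by (intro unique[OF ij tp(1)[OF ij]]) auto
    qed
  next
    fix i j e p
    assume ij: "i \<in> {1..m}" "j \<in> {1..n}" and e: "e \<in> {l (j - 1), l j}"
      and p: "p lies_on e \<and> p \<noteq> meet (k (i - 1)) e \<and> p \<noteq> meet (k i) e"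
    have d: "distinct [k (i - 1), l (j - 1), k i, l j]"
      using generic[OF ij] by (simp add: generic_def)
    show "\<exists>!Q. Q \<in> touching_instances m n k l \<and> tangency_point (Q (i, j)) e p"
    proof (cases "e = l j")
      case True
      show ?thesis
        using p d meet_lies_on unfolding True
        by (intro unique[OF ij tp(4)[OF ij]]) auto
    next
      case False
      then have e: "e = l (j - 1)" using e by simp
      show ?thesis
        using p d meet_lies_on unfolding e
        by (intro unique[OF ij tp(2)[OF ij]]) auto
    qed
  qed
qed

section \<open>The dual grid of an incircular net\<close>

text \<open>This makes lines of the dual grid distinct that belong to the same family and are at most two steps apart. If
the points coincided, \<open>a (i - 1)\<close>, \<open>a i\<close>, \<open>a (i + 1)\<close> would be three concurrent tangents.\<close>

lemma consecutive_tangents_meets_distinct: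
  fixes m i i' :: nat
  assumes nd: "nondegenerate C" and tangent: "\<And>i. i \<le> m \<Longrightarrow> tangent C (a i)"
    and neq: "\<And>i. i \<in> {1..m} \<Longrightarrow> a (i - 1) \<noteq> a i" and step2: "\<And>i. i \<in> {1..<m} \<Longrightarrow> a (i - 1) \<noteq> a (i + 1)"
    and i: "1 \<le> i" "i' = i + 1 \<or> i' = i + 2" "i' \<le> m"
  shows "meet (a (i - 1)) (a i) \<noteq> meet (a (i' - 1)) (a i')"
proof
  assume eq: "meet (a (i - 1)) (a i) = meet (a (i' - 1)) (a i')"
  have n: "a (i - 1) \<noteq> a i" "a (i' - 1) \<noteq> a i'" "a i \<noteq> a (i + 1)" "a (i - 1) \<noteq> a (i + 1)"
    using neq[of i] neq[of i'] neq[of "i + 1"] step2[of i] i by auto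
  have "meet (a (i - 1)) (a i) lies_on a (i + 1)"
    using i(2) meet_lies_on[OF n(2)] unfolding eq by auto
  with meet_lies_on[OF n(1)] show False
    using tangents_not_concurrent[OF nd, of "a (i - 1)" "a i" "a (i + 1)"] tangent n i by auto
qed

lemma generic_not_concurrent:
  assumes "generic k l k' l'" "f \<in> {k, l, k', l'}" "g \<in> {k, l, k', l'}" "h \<in> {k, l, k', l'}" "distinct [f, g, h]"
  shows "\<not> (p lies_on f \<and> p lies_on g \<and> p lies_on h)"
  using assms unfolding generic_def by blast

lemma meet_finite:
  assumes "u \<noteq> 0" "v \<noteq> 0" "lin u \<noteq> lin v" "meet (lin u) (lin v) \<in> range eucl"
  shows "cross3 u v $ 3 \<noteq> 0"
proof -
  have x: "cross3 u v \<noteq> 0"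
    using assms by (simp add: lin_eq_cross)
  then obtain p where "pt (cross3 u v) = pt (hom p)"
    using assms by (auto simp: meet_lin eucl_pt)
  then obtain c where "hom p = c *\<^sub>R cross3 u v"
    using x by (auto simp: pt_eq_iff hom_nonzero)
  then have "1 = c * cross3 u v $ 3"
    by (metis hom_components(3) vector_scaleR_component real_scaleR_def)
  then show ?thesis by auto
qed

theorem theorem9:
  fixes m n :: nat and a b :: "nat \<Rightarrow> pline"
  assumes "incircular_net m n a b"
  shows "\<exists>k l :: nat \<Rightarrow> pline.
    (\<forall>i\<in>{1..m}. angle_bisector (k i) (a (i - 1)) (a i)) \<and>
    (\<forall>j\<in>{1..n}. angle_bisector (l j) (b (j - 1)) (b j)) \<and>
    (\<forall>i\<in>{1..m}. \<forall>j\<in>{1..n}. k i \<noteq> l j \<and>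
      (\<exists>c r. inscribed_circle c r (a (i - 1)) (b (j - 1)) (a i) (b j) \<and>
        meet (k i) (l j) = eucl c)) \<and>
    line_grid (m - 1) (n - 1) (\<lambda>i. k (i + 1)) (\<lambda>j. l (j + 1)) \<and>
    admits_touching_family (m - 1) (n - 1) (\<lambda>i. k (i + 1)) (\<lambda>j. l (j + 1))"
proof -
  have mn: "1 \<le> m" "1 \<le> n" and grid: "line_grid m n a b"
    and fin: "\<And>i. i \<le> m \<Longrightarrow> a i \<noteq> line_at_infinity" "\<And>j. j \<le> n \<Longrightarrow> b j \<noteq> line_at_infinity"
    and eu: "\<And>i j. i \<le> m \<Longrightarrow> j \<le> n \<Longrightarrow> meet (a i) (b j) \<in> range eucl"
    using assms by (auto simp: incircular_net_def)
  have gen: "generic (a (i - 1)) (b (j - 1)) (a i) (b j)" if "i \<in> {1..m}" "j \<in> {1..n}" for i j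
    using grid that by (simp add: line_grid_def)
  have step2: "i \<in> {1..<m} \<Longrightarrow> a (i - 1) \<noteq> a (i + 1)" "j \<in> {1..<n} \<Longrightarrow> b (j - 1) \<noteq> b (j + 1)" for i j
    using grid by (auto simp: line_grid_def)
  have neq: "i \<in> {1..m} \<Longrightarrow> a (i - 1) \<noteq> a i" "j \<in> {1..n} \<Longrightarrow> b (j - 1) \<noteq> b j" for i j
    using gen[of i 1] gen[of 1 j] mn by (auto simp: generic_def)
  obtain C D where nd: "nondegenerate C" "nondegenerate D" and conf: "confocal C D"
    and tangC: "\<And>i. i \<le> m \<Longrightarrow> tangent C (a i)" "\<And>j. j \<le> n \<Longrightarrow> tangent C (b j)"
    and onD: "\<And>i. i \<in> {1..m} \<Longrightarrow> on_conic D (meet (a (i - 1)) (a i))"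
      "\<And>j. j \<in> {1..n} \<Longrightarrow> on_conic D (meet (b (j - 1)) (b j))"
    using assms unfolding incircular_net_def by blast
  obtain M N M' N' \<kappa> where cc: "dual_pair M N" "dual_pair M' N'" "\<kappa> \<noteq> 0"
    "\<And>u v. u \<bullet> (N' *v v) = \<kappa> * (u \<bullet> (N *v v)) + (1 - \<kappa>) * (u $ 1 * v $ 1 + u $ 2 * v $ 2)"
    and C: "C = con M" and D: "D = con M'"
    by (rule confocal_dual[OF nd conf]) (rule that)
  interpret confocal_conics M N M' N' \<kappa>
    using cc by unfold_locales
  have "\<exists>w. w \<noteq> 0 \<and> lin w = L" for L
    by (rule lin_cases[of L]) blast
  then obtain rep where rep: "\<And>L. rep L \<noteq> 0" "\<And>L. lin (rep L) = L"
    by metis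
  define u where "u i = rep (a i)" for i
  define v where "v j = rep (b j)" for j
  have u: "u i \<noteq> 0" "a i = lin (u i)" for i
    by (simp_all add: u_def rep)
  have v: "v j \<noteq> 0" "b j = lin (v j)" for j
    by (simp_all add: v_def rep)
  have tu: "tangents_on (u (i - 1)) (u i)" if "i \<in> {1..m}" for i
  proof -
    have "i - 1 \<le> m" "i \<le> m" using that by auto
    then show ?thesis
      using neq(1)[OF that] onD(1)[OF that] fin(1) tangC(1) u unfolding C D
      by (intro tangents_on_lines) metis+
  qed
  have tv: "tangents_on (v (j - 1)) (v j)" if "j \<in> {1..n}" for j
  proof -
    have "j - 1 \<le> n" "j \<le> n" using that by auto
    then show ?thesis
      using neq(2)[OF that] onD(2)[OF that] fin(2) tangC(2) v unfolding C D
      by (intro tangents_on_lines) metis+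
  qed
  define x where "x i = cross3 (u (i - 1)) (u i)" for i
  define y where "y j = cross3 (v (j - 1)) (v j)" for j
  define k where "k i = lin (M' *v x i)" for i
  define l where "l j = lin (M' *v y j)" for j
  have x: "x i \<noteq> 0" "x i \<bullet> (M' *v x i) = 0" "meet (a (i - 1)) (a i) = pt (x i)" if "i \<in> {1..m}" for i
    using tangents_on_cases(5,6)[OF tu[OF that] insertI1] u by (simp_all add: x_def meet_lin)
  have y: "y j \<noteq> 0" "y j \<bullet> (M' *v y j) = 0" "meet (b (j - 1)) (b j) = pt (y j)" if "j \<in> {1..n}" for j
    using tangents_on_cases(5,6)[OF tv[OF that] insertI1] v by (simp_all add: y_def meet_lin)
  have xy: "pt (x i) \<noteq> pt (y j)" if ij: "i \<in> {1..m}" "j \<in> {1..n}" for i j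
  proof
    assume "pt (x i) = pt (y j)"
    then have "pt (x i) lies_on a (i - 1) \<and> pt (x i) lies_on a i \<and> pt (x i) lies_on b j"
      using meet_lies_on[OF neq(1)[OF ij(1)]] meet_lies_on[OF neq(2)[OF ij(2)]] x(3)[OF ij(1)] y(3)[OF ij(2)] by metis
    moreover have "distinct [a (i - 1), a i, b j]"
      using gen[OF ij] by (auto simp: generic_def)
    ultimately show False
      using generic_not_concurrent[OF gen[OF ij], of "a (i - 1)" "a i" "b j"] by blast
  qed
  have kl: "k i \<noteq> l j" if "i \<in> {1..m}" "j \<in> {1..n}" for i j
    using polar_eq_iff x(1)[OF that(1)] y(1)[OF that(2)] xy[OF that] by (simp add: k_def l_def)
  have kk: "k i \<noteq> k i'" if i: "1 \<le> i" "i' = i + 1 \<or> i' = i + 2" "i' \<le> m" for i i'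
  proof -
    have "i \<in> {1..m}" "i' \<in> {1..m}" using i by auto
    then show ?thesis
      using consecutive_tangents_meets_distinct[where m = m and a = a, OF nd(1) tangC(1) neq(1) step2(1) i]
        x polar_eq_iff[of "x i" "x i'"] by (simp add: k_def)
  qed
  have ll: "l i \<noteq> l i'" if i: "1 \<le> i" "i' = i + 1 \<or> i' = i + 2" "i' \<le> n" for i i'
  proof -
    have "i \<in> {1..n}" "i' \<in> {1..n}" using i by auto
    then show ?thesis
      using consecutive_tangents_meets_distinct[where m = n and a = b, OF nd(1) tangC(2) neq(2) step2(2) i]
        y polar_eq_iff[of "y i" "y i'"] by (simp add: l_def)
  qed
  have tk: "tangent D (k i)" if "i \<in> {1..m}" for i
    using x[OF that] polar_tangent by (simp add: D k_def)
  have tl: "tangent D (l j)" if "j \<in> {1..n}" for j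
    using y[OF that] polar_tangent by (simp add: D l_def)
  have generic': "generic (k i) (l j) (k (i + 1)) (l (j + 1))" if "i \<in> {1..m - 1}" "j \<in> {1..n - 1}" for i j
  proof -
    have ij: "i \<in> {1..m}" "j \<in> {1..n}" "i + 1 \<in> {1..m}" "j + 1 \<in> {1..n}"
      using that by auto
    have "distinct [k i, l j, k (i + 1), l (j + 1)]"
      using kl[OF ij(1,2)] kl[OF ij(1,4)] kl[OF ij(3,2)] kl[OF ij(3,4)] kk[of i "i + 1"] ll[of j "j + 1"] ij
      by auto
    moreover have "\<forall>h\<in>{k i, l j, k (i + 1), l (j + 1)}. tangent D h"
      using tk tl ij by auto
    ultimately show ?thesis
      unfolding generic_def using tangents_not_concurrent[OF nd(2)] by blast
  qed
  have "angle_bisector (k i) (a (i - 1)) (a i)" if "i \<in> {1..m}" for i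
    using tangents_on_bisector[OF tu[OF that]] by (simp add: k_def x_def u)
  moreover have "angle_bisector (l j) (b (j - 1)) (b j)" if "j \<in> {1..n}" for j
    using tangents_on_bisector[OF tv[OF that]] by (simp add: l_def y_def v)
  moreover have "\<exists>c r. inscribed_circle c r (a (i - 1)) (b (j - 1)) (a i) (b j) \<and> meet (k i) (l j) = eucl c"
    if ij: "i \<in> {1..m}" "j \<in> {1..n}" for i j
  proof -
    have "cross3 (x i) (y j) \<noteq> 0"
      using xy[OF ij] x(1)[OF ij(1)] y(1)[OF ij(2)] by (simp add: pt_eq_cross)
    moreover have "cross3 p q $ 3 \<noteq> 0" if pq: "p \<in> {u (i - 1), u i}" "q \<in> {v (j - 1), v j}" for p q
    proof -
      have "distinct [a (i - 1), b (j - 1), a i, b j]"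
        using gen[OF ij] by (simp add: generic_def)
      moreover obtain i' j' where *: "p = u i'" "q = v j'" "i' = i - 1 \<or> i' = i" "j' = j - 1 \<or> j' = j"
        using pq by auto
      ultimately have "a i' \<noteq> b j'"
        by auto
      moreover have "meet (a i') (b j') \<in> range eucl"
        using ij *(3,4) by (intro eu) auto
      ultimately show ?thesis
        using meet_finite[OF u(1) v(1)] by (simp add: *(1,2) u(2) v(2))
    qed
    ultimately show ?thesis
      using circle_centre(2)[OF tu[OF ij(1)] tv[OF ij(2)]] by (simp add: x_def y_def k_def l_def u v)
  qed
  moreover have "line_grid (m - 1) (n - 1) (\<lambda>i. k (i + 1)) (\<lambda>j. l (j + 1))"
    using generic' kk ll by (auto simp: line_grid_def)
  moreover have "admits_touching_family (m - 1) (n - 1) (\<lambda>i. k (i + 1)) (\<lambda>j. l (j + 1))"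
    using generic' tk tl mn by (intro tangent_grid_admits_touching_family[OF nd(2)]) auto
  ultimately show ?thesis
    using kl by blast
qed

end
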